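(* Let $0<\beta\le1<\alpha\le2$, $a>0$, and let $f:\mathbb{R}\to\mathbb{R}$ be of class $C^1$. Let $x^*$ be an equilibrium of $$\Delta^{\alpha}x(t)+a\,\Delta^{\beta}x(t+\alpha-\beta-1)=f\bigl(x(t+\alpha-2)\bigr)-x(t+\alpha-2),\qquad t\in\mathbb{N}_{2-\alpha},$$ so that $f(x^* )=x^*$, and set $b^*=f'(x^* )$. For $\theta\in[0,2\pi]$ let $$\gamma(\theta)=1+2^{\alpha}\Bigl(\sin\tfrac{\theta}{2}\Bigr)^{\alpha}e^{\mathrm{i}\left[\frac{\alpha\pi}{2}+\theta\left(2-\frac{\alpha}{2}\right)\right]}+a\,2^{\beta}\Bigl(\sin\tfrac{\theta}{2}\Bigr)^{\beta}e^{\mathrm{i}\left[\frac{\beta\pi}{2}+\theta\left(1-\frac{\beta}{2}\right)\right]},$$ and assume $b^*\notin\gamma([0,2\pi])$. Then the linearization about $x^*$ is asymptotically stable if and only if $$\operatorname{Ind}_{\gamma}(b^* )=2.$$ For the logistic nonlinearity $f(x)=\mu x(1-x)$, $\mu\in\mathbb{R}$, this condition becomes $$\operatorname{Ind}_{\gamma}(\mu)=2\ \text{ at }x_1^*=0,\qquad \operatorname{Ind}_{\gamma}(2-\mu)=2\ \text{ at }x_2^*=1-\frac1\mu\quad(\mu\neq0).$$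
   Context: Notation: $\mathbb{N}_0=\{0,1,2,\dots\}$, $\mathbb{N}_r=\{r,r+1,r+2,\dots\}$ for real $r$. Solutions are sequences $x$ on $\mathbb{N}_0$ with initial data $x(0),x(1)$. Fractional sum of order $\nu>0$: $(\Delta^{-\nu}x)(t)=\frac{1}{\Gamma(\nu)}\sum_{s=0}^{n}\frac{\Gamma(n-s+\nu)}{\Gamma(n-s+1)}x(s)$ for $t=\nu+n$, $n\in\mathbb{N}_0$. Caputo-like difference: for $m-1<\mu<m$, $m\in\mathbb{N}$, $\Delta^{\mu}x(t)=\Delta^{-(m-\mu)}(\Delta^m x)(t)$, $t\in\mathbb{N}_{m-\mu}$, where $\Delta^m x(t)=\sum_{k=0}^m\binom{m}{k}(-1)^{m-k}x(t+k)$; at integer order it is the ordinary forward difference. Explicitly, with $\phi_\nu(m)=\frac{\Gamma(m+\nu)}{\Gamma(\nu)\Gamma(m+1)}$ for $\nu>0$, and $\phi_0(0)=1$, $\phi_0(m)=0$ for $m\ge1$, the equation (with $t=2-\alpha+n$) reads $$\sum_{s=0}^{n}\phi_{2-\alpha}(n-s)\Delta^2x(s)+a\sum_{s=0}^{n}\phi_{1-\beta}(n-s)\Delta x(s)=f(x(n))-x(n),\qquad n\in\mathbb{N}_0.$$ The linearization about $x^*$ is the linear equation for $y=x-x^*$ $$\Delta^{\alpha}y(t)+a\,\Delta^{\beta}y(t+\alpha-\beta-1)=(b^*-1)\,y(t+\alpha-2),\qquad t\in\mathbb{N}_{2-\alpha}.$$ It is asymptotically stable if its zero solution is asymptotically stable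 in the standard sense with respect to the initial data $(y(0),y(1))$ (stable, and solutions tend to $0$ as $n\to\infty$). Winding number: for a closed curve $\eta:[0,2\pi]\to\mathbb{C}$ and $\lambda\notin\eta([0,2\pi])$, $\operatorname{Ind}_\eta(\lambda)=\frac{1}{2\pi\mathrm{i}}\int_0^{2\pi}\frac{\eta'(\theta)}{\eta(\theta)-\lambda}\,d\theta$. (For $\gamma$ above, $\gamma'$ may be unbounded at the endpoints but is integrable.) Convention: $0^\alpha=0^\beta=0$. *)

theory Defs
  imports "HOL-Analysis.Analysis"
begin

text \<open>
  A function on a grid \<open>N_from r = {r, r + 1, r + 2, \<dots>}\<close> is represented by a total function
  on the reals; only its values on the grid are ever used. In particular, a sequence on
  the natural numbers is a function \<open>real \<Rightarrow> real\<close> read off at the points \<open>real n\<close>.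
\<close>

definition N_from :: "real \<Rightarrow> real set" where
  "N_from r = range (\<lambda>n::nat. r + real n)"

text \<open>
  For \<open>\<nu> > 0\<close> and \<open>t \<in> N_from \<nu>\<close>; the upper summation index is the \<open>n\<close> with \<open>t = \<nu> + n\<close>.
\<close>

definition frac_sum :: "real \<Rightarrow> (real \<Rightarrow> real) \<Rightarrow> real \<Rightarrow> real" where
  "frac_sum \<nu> x t =
     (let n = nat \<lfloor>t - \<nu>\<rfloor> in
      1 / Gamma \<nu> *
        (\<Sum>s\<le>n. Gamma (real n - real s + \<nu>) / Gamma (real n - real s + 1) * x (real s)))"

definition fwd_diff :: "nat \<Rightarrow> (real \<Rightarrow> real) \<Rightarrow> real \<Rightarrow> real" where
  "fwd_diff m x t = (\<Sum>k\<le>m. real (m choose k) * (- 1) ^ (m - k) * x (t + real k))"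

text \<open>
  For \<open>\<mu> > 0\<close>, as a function on \<open>N_from (\<lceil>\<mu>\<rceil> - \<mu>)\<close>. At integer order it is the ordinary
  forward difference (\<open>frac_sum 0\<close> would vanish identically, since \<open>Gamma 0 = 0\<close> here).
\<close>

definition caputo_diff :: "real \<Rightarrow> (real \<Rightarrow> real) \<Rightarrow> real \<Rightarrow> real" where
  "caputo_diff \<mu> x t =
     (let m = nat \<lceil>\<mu>\<rceil> in
      if \<mu> = real m then fwd_diff m x t
      else frac_sum (real m - \<mu>) (fwd_diff m x) t)"

definition solution ::
  "real \<Rightarrow> real \<Rightarrow> real \<Rightarrow> (real \<Rightarrow> real) \<Rightarrow> (real \<Rightarrow> real) \<Rightarrow> bool" where
  "solution \<alpha> \<beta> a f x \<longleftrightarrow>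
     (\<forall>t \<in> N_from (2 - \<alpha>).
        caputo_diff \<alpha> x t + a * caputo_diff \<beta> x (t + \<alpha> - \<beta> - 1) =
          f (x (t + \<alpha> - 2)) - x (t + \<alpha> - 2))"

definition equilibrium ::
  "real \<Rightarrow> real \<Rightarrow> real \<Rightarrow> (real \<Rightarrow> real) \<Rightarrow> real \<Rightarrow> bool" where
  "equilibrium \<alpha> \<beta> a f c \<longleftrightarrow> solution \<alpha> \<beta> a f (\<lambda>_. c)"

definition linearized_solution ::
  "real \<Rightarrow> real \<Rightarrow> real \<Rightarrow> (real \<Rightarrow> real) \<Rightarrow> real \<Rightarrow> (real \<Rightarrow> real) \<Rightarrow> bool" where
  "linearized_solution \<alpha> \<beta> a f c y \<longleftrightarrow>
     (\<forall>t \<in> N_from (2 - \<alpha>).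
        caputo_diff \<alpha> y t + a * caputo_diff \<beta> y (t + \<alpha> - \<beta> - 1) =
          (deriv f c - 1) * y (t + \<alpha> - 2))"

text \<open>
  Asymptotic stability of the zero solution, with respect to the initial data \<open>(y 0, y 1)\<close>,
  of a linear equation whose solutions are the \<open>y\<close> with \<open>S y\<close>. By linearity, attractivity
  is asked of all solutions rather than only of those with small initial data.
\<close>

definition asymptotically_stable :: "((real \<Rightarrow> real) \<Rightarrow> bool) \<Rightarrow> bool" where
  "asymptotically_stable S \<longleftrightarrow>
     (\<forall>\<epsilon>>0. \<exists>\<delta>>0. \<forall>y. S y \<longrightarrow> \<bar>y 0\<bar> < \<delta> \<longrightarrow> \<bar>y 1\<bar> < \<delta> \<longrightarrow> (\<forall>n::nat. \<bar>y (real n)\<bar> < \<epsilon>)) \<and>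
     (\<forall>y. S y \<longrightarrow> (\<lambda>n::nat. y (real n)) \<longlonglongrightarrow> 0)"

definition gamma_curve :: "real \<Rightarrow> real \<Rightarrow> real \<Rightarrow> real \<Rightarrow> complex" where
  "gamma_curve \<alpha> \<beta> a \<theta> =
     1 + of_real (2 powr \<alpha> * sin (\<theta> / 2) powr \<alpha>)
           * exp (\<i> * of_real (\<alpha> * pi / 2 + \<theta> * (2 - \<alpha> / 2)))
       + of_real (a * 2 powr \<beta> * sin (\<theta> / 2) powr \<beta>)
           * exp (\<i> * of_real (\<beta> * pi / 2 + \<theta> * (1 - \<beta> / 2)))"

text \<open>
  Curves are parametrized by \<open>[0, 2\<pi>]\<close> and need only have an integrable derivative on the
  open interval, so the integral is written out rather than taken as a \<open>contour_integral\<close>.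
\<close>

definition Ind :: "(real \<Rightarrow> complex) \<Rightarrow> complex \<Rightarrow> complex" where
  "Ind \<eta> z =
     1 / (2 * of_real pi * \<i>) *
       integral {0..2 * pi} (\<lambda>\<theta>. vector_derivative \<eta> (at \<theta>) / (\<eta> \<theta> - z))"

definition logistic :: "real \<Rightarrow> real \<Rightarrow> real" where
  "logistic \<mu> x = \<mu> * x * (1 - x)"

end

(* With z-transform variable w = 1/z, the linearization becomes D(w) Y(w) = R(w), where
   D(w) = (1 - w)^alpha + a w (1 - w)^beta - (b - 1) w^2 and the coefficients of R tend to 0.
   The coefficients of D are absolutely summable, so if D has no zero in the closed unit disc,
   Wiener's lemma makes those of 1/D summable, and the coefficients of Y = R/D are a convolution
   that tends to 0, uniformly small in the initial data. A zero of D in the open disc is instead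
   a point where the solution with y(0) = 0, y(1) = 1 violates the equation if it is bounded.
   On the circle, gamma(theta) - b = w^(-2) D(w) with w = exp(-i theta), so the index of gamma
   is 2 minus the number of zeros of D in the disc, by the argument principle. *)
theory Submission
  imports Defs "HOL-Complex_Analysis.Complex_Analysis"
begin

unbundle no vec_syntax

section \<open>Wiener's lemma for power series\<close>

text \<open>The branch point w = 1 of D lies on the unit circle. In general 1/D therefore has no
  analytic continuation beyond the disc, and its coefficients need not decay geometrically. Absolute
  summability is still enough for convolution to preserve null sequences, and this is why Wiener's
  lemma is called for. The same point can make the derivative of gamma unbounded at both ends. So
  the argument principle is applied on a circle of radius r < 1 and carried to the unit circle by
  homotopy, and the index integral is evaluated through a continuous logarithm. The data y(0) = 0,
  y(1) = 1 are chosen because then R(w) = w (1 - w)^(\<alpha> - 2). In the open disc this vanishes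
  only at 0, where D = 1, so no zero of D can be cancelled. The 2 in the index is the winding of
  w^(-2) along w = exp(-i theta). The minus sign before the number of zeros comes from this circle
  being run clockwise.\<close>

definition trunc_norm :: "nat \<Rightarrow> 'a :: real_normed_field fps \<Rightarrow> real" where
  "trunc_norm K F = (\<Sum>k\<le>K. norm (F $ k))"

lemma trunc_norm_nonneg: "trunc_norm K F \<ge> 0"
  by (simp add: trunc_norm_def sum_nonneg)

lemma trunc_norm_1: "trunc_norm K 1 = 1"
proof -
  have "trunc_norm K 1 = (\<Sum>k\<le>K. if k = 0 then 1 else 0)"
    unfolding trunc_norm_def by (intro sum.cong) auto
  then show ?thesis by simp
qed

lemma trunc_norm_add: "trunc_norm K (F + G) \<le> trunc_norm K F + trunc_norm K G"
  unfolding trunc_norm_def sum.distrib[symmetric] by (intro sum_mono) (auto simp: norm_triangle_ineq)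

text \<open>The pairs with i + j \<le> K form a triangle inside the square {..K} x {..K}, so
  truncation keeps the norm submultiplicative while every norm is a finite sum.\<close>

lemma trunc_norm_mult: "trunc_norm K (F * G) \<le> trunc_norm K F * trunc_norm K G"
proof -
  have "trunc_norm K (F * G) \<le> (\<Sum>k\<le>K. \<Sum>i\<le>k. norm (F $ i) * norm (G $ (k - i)))"
    unfolding trunc_norm_def
    by (intro sum_mono)
      (auto simp: fps_mult_nth atLeast0AtMost norm_mult[symmetric] intro!: sum_norm_le)
  also have "\<dots> = (\<Sum>(i, j)\<in>{(i, j). i + j \<le> K}. norm (F $ i) * norm (G $ j))"
    by (simp add: sum.triangle_reindex_eq)
  also have "\<dots> \<le> (\<Sum>(i, j)\<in>{..K} \<times> {..K}. norm (F $ i) * norm (G $ j))"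
    by (intro sum_mono2) auto
  also have "\<dots> = trunc_norm K F * trunc_norm K G"
    by (simp add: trunc_norm_def sum_product sum.cartesian_product)
  finally show ?thesis .
qed

lemma trunc_norm_power: "trunc_norm K (F ^ n) \<le> trunc_norm K F ^ n"
proof (induction n)
  case (Suc n)
  have "trunc_norm K (F ^ Suc n) \<le> trunc_norm K F * trunc_norm K (F ^ n)"
    by (simp add: trunc_norm_mult)
  also have "\<dots> \<le> trunc_norm K F * trunc_norm K F ^ n"
    by (intro mult_left_mono Suc.IH trunc_norm_nonneg)
  finally show ?case by simp
qed (simp add: trunc_norm_1)

lemma trunc_norm_le_suminf:
  assumes "summable (\<lambda>n. norm (F $ n))"
  shows "trunc_norm K F \<le> (\<Sum>n. norm (F $ n))"
  unfolding trunc_norm_def by (intro sum_le_suminf assms) auto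

lemma summable_norm_fps_iff_bounded:
  "summable (\<lambda>n. norm (F $ n)) \<longleftrightarrow> (\<exists>B. \<forall>K. trunc_norm K F \<le> B)"
proof
  assume "\<exists>B. \<forall>K. trunc_norm K F \<le> B"
  then obtain B where B: "\<And>K. trunc_norm K F \<le> B" by auto
  show "summable (\<lambda>n. norm (F $ n))"
  proof (rule summableI_nonneg_bounded[where x = B])
    fix n
    have "(\<Sum>i<n. norm (F $ i)) \<le> trunc_norm n F"
      unfolding trunc_norm_def by (intro sum_mono2) auto
    with B[of n] show "(\<Sum>i<n. norm (F $ i)) \<le> B" by linarith
  qed auto
qed (use trunc_norm_le_suminf in auto)

lemma summable_norm_fps_mult:
  fixes F G :: "'a :: real_normed_field fps"
  assumes "summable (\<lambda>n. norm (F $ n))" "summable (\<lambda>n. norm (G $ n))"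
  shows "summable (\<lambda>n. norm ((F * G) $ n))"
  unfolding summable_norm_fps_iff_bounded
proof (intro exI allI)
  fix K
  show "trunc_norm K (F * G) \<le> (\<Sum>n. norm (F $ n)) * (\<Sum>n. norm (G $ n))"
    by (rule order.trans[OF trunc_norm_mult])
      (intro mult_mono trunc_norm_le_suminf assms suminf_nonneg trunc_norm_nonneg norm_ge_zero)
qed

text \<open>On the closed disc \<open>norm (F $ n)\<close> majorizes the n-th term, so convergence
  is uniform up to the boundary, where analyticity may fail.\<close>

lemma continuous_on_eval_fps_cball:
  fixes F :: "'a :: {banach, real_normed_field} fps"
  assumes "summable (\<lambda>n. norm (F $ n))"
  shows "continuous_on (cball 0 1) (eval_fps F)"
proof -
  have "uniform_limit (cball 0 1) (\<lambda>n w. \<Sum>i<n. F $ i * w ^ i) (eval_fps F) sequentially"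
    unfolding eval_fps_def
    by (rule Weierstrass_m_test[OF _ assms])
      (auto simp: norm_mult norm_power intro!: mult_left_le power_le_one)
  then show ?thesis
    by (rule uniform_limit_theorem[rotated]) (auto intro!: always_eventually continuous_intros)
qed

text \<open>Cauchy's inequality at radius R > 1 bounds the n-th coefficient by B / R^n, and R / (R -
  1) is the sum of the geometric series. This factor depends on R only, so one constant serves all
  powers of 1/P.\<close>

lemma Cauchy_fps_nth_bound:
  assumes "f holomorphic_on ball 0 R'" "1 < R" "R < R'" "f has_fps_expansion F"
    and "\<And>w. norm w \<le> R \<Longrightarrow> norm (f w) \<le> B"
  shows "trunc_norm K F \<le> B * (R / (R - 1))"
proof -
  have B: "B \<ge> 0" using assms(5)[of 0] assms(2) norm_ge_zero[of "f 0"] by (simp del: norm_ge_zero)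
  have "norm (F $ n) \<le> B * (1 / R) ^ n" for n
  proof -
    have "norm ((deriv ^^ n) f 0) \<le> fact n * B / R ^ n"
    proof (rule Cauchy_inequality)
      show "f holomorphic_on ball 0 R"
        by (rule holomorphic_on_subset[OF assms(1)]) (use assms(3) in auto)
      show "continuous_on (cball 0 R) f"
        by (rule holomorphic_on_imp_continuous_on, rule holomorphic_on_subset[OF assms(1)])
          (use assms(3) in auto)
    qed (use assms in auto)
    moreover have "R ^ n > 0" using assms(2) by simp
    ultimately show ?thesis
      by (simp add: fps_nth_fps_expansion[OF assms(4)] norm_divide power_divide field_simps)
  qed
  then have "trunc_norm K F \<le> (\<Sum>k\<le>K. B * (1 / R) ^ k)"
    unfolding trunc_norm_def by (intro sum_mono)
  also have "\<dots> = B * (\<Sum>k\<le>K. (1 / R) ^ k)" by (simp add: sum_distrib_left)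
  also have "\<dots> \<le> B * (\<Sum>k. (1 / R) ^ k)"
    using assms(2) by (intro mult_left_mono sum_le_suminf B summable_geometric) auto
  also have "(\<Sum>k. (1 / R) ^ k) = R / (R - 1)"
    using assms(2) by (subst suminf_geometric) (auto simp: field_simps)
  finally show ?thesis .
qed

lemma has_fps_expansion_power':
  fixes f :: "'a :: {banach, real_normed_field} \<Rightarrow> 'a"
  shows "f has_fps_expansion F \<Longrightarrow> (\<lambda>w. f w ^ n) has_fps_expansion F ^ n"
  by (induction n) (auto intro: has_fps_expansion_mult)

text \<open>
  Newman's proof of Wiener's lemma: \<open>F\<close> is perturbed to a polynomial \<open>P\<close>, the norms of the powers
  of \<open>1/P\<close> are bounded by Cauchy's inequality on a slightly larger disc, and \<open>1/F\<close> is expanded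
  in a Neumann series. Truncated norms avoid any convergence argument for formal power series.
\<close>

theorem wiener_fps:
  fixes F :: "complex fps"
  assumes F: "summable (\<lambda>n. norm (F $ n))"
    and nz: "\<And>w. norm w \<le> 1 \<Longrightarrow> eval_fps F w \<noteq> 0"
  shows "summable (\<lambda>n. norm (inverse F $ n))"
proof -
  have cont: "continuous_on (cball 0 1) (eval_fps F)"
    by (rule continuous_on_eval_fps_cball[OF F])
  obtain w0 where w0: "w0 \<in> cball 0 1" "\<And>w. w \<in> cball 0 1 \<Longrightarrow> norm (eval_fps F w0) \<le> norm (eval_fps F w)"
    using continuous_attains_inf[OF compact_cball _ continuous_on_norm[OF cont]] by fastforce
  define d where "d = norm (eval_fps F w0)"
  have d: "d > 0" using nz w0(1) by (auto simp: d_def)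
  have F0: "F $ 0 \<noteq> 0" using nz[of 0] by (simp add: eval_fps_at_0)
  \<comment> \<open>The tail costs at most d/4. This leaves \<open>norm (p w)\<close> \<ge> 3d/4 on
    the disc and > d/2 on a slightly larger one, and the Neumann ratio becomes d/4 times 2/d, that
    is 1/2.\<close>
  obtain N where N: "\<And>n. n \<ge> N \<Longrightarrow> norm (\<Sum>i. norm (F $ (i + n))) < d / 4"
    using suminf_exist_split[OF _ F, of "d / 4"] d by auto
  define P where "P = fps_cutoff N F"
  define p where "p w = (\<Sum>i<N. F $ i * w ^ i)" for w
  have sumF: "summable (\<lambda>n. F $ n * w ^ n)" if "norm w \<le> 1" for w
    by (rule summable_comparison_test'[OF F, of 0])
      (use that in \<open>auto simp: norm_mult norm_power intro!: mult_left_le power_le_one\<close>)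
  have eval_P: "eval_fps P w = p w" for w
    unfolding eval_fps_def p_def P_def
    by (subst suminf_finite[of "{..<N}"]) auto
  have radius: "fps_conv_radius P = \<infinity>"
    unfolding fps_conv_radius_def P_def
    by (intro conv_radius_inftyI'' summable_finite[of "{..<N}"]) auto
  have p_exp: "p has_fps_expansion P"
    using eval_fps_has_fps_expansion[of P] radius by (simp add: eval_P[abs_def])
  have tail: "trunc_norm K (P - F) \<le> d / 4" for K
  proof -
    have eq: "norm ((P - F) $ n) = (if n < N then 0 else norm (F $ n))" for n
      by (simp add: P_def)
    have s: "summable (\<lambda>n. norm ((P - F) $ n))"
      unfolding eq by (rule summable_comparison_test'[OF F, of 0]) auto
    have "trunc_norm K (P - F) \<le> (\<Sum>n. norm ((P - F) $ n))"
      by (rule trunc_norm_le_suminf[OF s])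
    also have "\<dots> = (\<Sum>n. norm ((P - F) $ (n + N))) + (\<Sum>i<N. norm ((P - F) $ i))"
      by (rule suminf_split_initial_segment[OF s])
    also have "\<dots> = (\<Sum>n. norm (F $ (n + N)))" unfolding eq by simp
    also have "\<dots> \<le> d / 4" using N[of N] by auto
    finally show ?thesis .
  qed
  have p_ge: "norm (p w) \<ge> 3 / 4 * d" if w: "norm w \<le> 1" for w
  proof -
    have "eval_fps F w = (\<Sum>n. F $ (n + N) * w ^ (n + N)) + p w"
      unfolding p_def eval_fps_def by (rule suminf_split_initial_segment[OF sumF[OF w]])
    moreover have "norm (\<Sum>n. F $ (n + N) * w ^ (n + N)) \<le> (\<Sum>n. norm (F $ (n + N)))"
      by (rule norm_suminf_le)
        (use F w in \<open>auto simp: norm_mult norm_power summable_iff_shift[of "\<lambda>n. norm (F $ n)"]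
            intro!: mult_left_le power_le_one\<close>)
    moreover have "(\<Sum>n. norm (F $ (n + N))) < d / 4" using N[of N] by auto
    moreover have "norm (eval_fps F w) \<ge> d" using w0(2) w by (auto simp: d_def)
    ultimately show ?thesis
      using norm_triangle_ineq[of "\<Sum>n. F $ (n + N) * w ^ (n + N)" "p w"] by auto
  qed
  have contp: "continuous_on UNIV p" unfolding p_def by (intro continuous_intros)
  have "open {w. norm (p w) > d / 2}"
    by (rule open_Collect_less) (auto intro!: continuous_intros contp)
  moreover have "cball 0 1 \<subseteq> {w. norm (p w) > d / 2}"
  proof
    fix w :: complex assume "w \<in> cball 0 1"
    with p_ge[of w] d show "w \<in> {w. norm (p w) > d / 2}" by auto
  qed
  ultimately obtain e where e: "e > 0" "(\<Union>w\<in>cball 0 1. ball w e) \<subseteq> {w. norm (p w) > d / 2}"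
    using compact_subset_open_imp_ball_epsilon_subset[OF compact_cball] by metis
  define R' where "R' = 1 + e"
  define R where "R = 1 + e / 2"
  have R: "1 < R" "R < R'" using e by (auto simp: R_def R'_def)
  have p_gt: "norm (p w) > d / 2" if w: "norm w < R'" for w
  proof (cases "norm w \<le> 1")
    case True
    with e(1) have "w \<in> (\<Union>w\<in>cball 0 1. ball w e)" by (auto intro!: bexI[of _ w])
    with e(2) show ?thesis by blast
  next
    case False
    \<comment> \<open>The point of the closed unit disc nearest to w is its radial
      projection.\<close>
    have "dist (w / norm w) w < e"
    proof -
      have "dist (w / norm w) w = norm (w * (1 / norm w - 1))"
        by (simp add: dist_norm algebra_simps)
      also have "\<dots> = norm w * \<bar>1 / norm w - 1\<bar>"
        by (simp only: norm_mult) (metis norm_of_real of_real_1 of_real_diff of_real_divide)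
      also have "\<dots> = norm w - 1" using False by (auto simp: abs_if field_simps)
      finally show ?thesis using w by (simp add: R'_def)
    qed
    moreover have "w / norm w \<in> cball 0 1" by (auto simp: norm_divide)
    ultimately have "w \<in> (\<Union>w\<in>cball 0 1. ball w e)" by (auto intro!: bexI[of _ "w / norm w"])
    with e(2) show ?thesis by blast
  qed
  define C where "C = R / (R - 1)"
  have C: "C > 0" using R by (simp add: C_def)
  have P0: "P $ 0 \<noteq> 0"
    using p_ge[of 0] d eval_P[of 0] by (auto simp: eval_fps_at_0)
  have Pinv: "trunc_norm K (inverse P ^ n) \<le> (2 / d) ^ n * C" for K n
    unfolding C_def
  proof (rule Cauchy_fps_nth_bound[where f = "\<lambda>w. inverse (p w) ^ n"])
    have "p w \<noteq> 0" if "norm w < R'" for w using p_gt[OF that] d by auto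
    then show "(\<lambda>w. inverse (p w) ^ n) holomorphic_on ball 0 R'"
      unfolding p_def by (intro holomorphic_intros) auto
    show "(\<lambda>w. inverse (p w) ^ n) has_fps_expansion inverse P ^ n"
      by (intro has_fps_expansion_power' has_fps_expansion_inverse p_exp P0)
    fix w :: complex assume "norm w \<le> R"
    then have "norm (p w) > d / 2" using p_gt[of w] R by auto
    then have "norm (inverse (p w)) \<le> inverse (d / 2)"
      unfolding norm_inverse using d by (intro le_imp_inverse_le) auto
    then have "norm (inverse (p w)) \<le> 2 / d" by simp
    then show "norm (inverse (p w) ^ n) \<le> (2 / d) ^ n"
      by (simp add: norm_power power_mono)
  qed (use R in auto)
  have iP: "inverse P * P = 1" and iF: "inverse F * F = 1"
    using P0 F0 by (auto simp: inverse_mult_eq_1)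
  \<comment> \<open>Q = 1 - F/P, so 1/F = (1/P) / (1 - Q) can be expanded in powers of Q.\<close>
  define Q where "Q = (P - F) * inverse P"
  have step: "inverse F = inverse P + Q * inverse F"
  proof -
    have "inverse P + Q * inverse F = inverse P + (P * inverse P) * inverse F - (inverse F * F) * inverse P"
      by (simp add: Q_def algebra_simps)
    also have "\<dots> = inverse F" using iP iF by (simp add: mult.commute)
    finally show ?thesis ..
  qed
  have expand: "inverse F = (\<Sum>n<M. Q ^ n) * inverse P + Q ^ M * inverse F" for M
  proof (induction M)
    case (Suc M)
    have "inverse F = (\<Sum>n<M. Q ^ n) * inverse P + Q ^ M * (inverse P + Q * inverse F)"
      using Suc step by simp
    then show ?case by (simp add: algebra_simps)
  qed simp
  \<comment> \<open>The powers of 1/P are gathered before estimating: Cauchy's inequality for the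
    whole power costs the factor C once, while submultiplicativity would cost C^(n + i). Here i = 1
    serves the Neumann terms and i = 0 the remainder.\<close>
  have bound: "trunc_norm K (Q ^ n * inverse P ^ i) \<le> (1 / 2) ^ n * ((2 / d) ^ i * C)" for K n i
  proof -
    have "Q ^ n * inverse P ^ i = (P - F) ^ n * inverse P ^ (n + i)"
      by (simp add: Q_def power_mult_distrib power_add)
    then have "trunc_norm K (Q ^ n * inverse P ^ i)
        \<le> trunc_norm K ((P - F) ^ n) * trunc_norm K (inverse P ^ (n + i))"
      by (simp add: trunc_norm_mult)
    also have "\<dots> \<le> trunc_norm K (P - F) ^ n * trunc_norm K (inverse P ^ (n + i))"
      by (intro mult_right_mono trunc_norm_power trunc_norm_nonneg)
    also have "\<dots> \<le> (d / 4) ^ n * ((2 / d) ^ (n + i) * C)"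
      by (intro mult_mono power_mono tail Pinv trunc_norm_nonneg zero_le_power) (use d in auto)
    also have "\<dots> = (d / 4 * (2 / d)) ^ n * ((2 / d) ^ i * C)"
      by (simp only: power_add power_mult_distrib mult_ac)
    also have "d / 4 * (2 / d) = 1 / 2" using d by simp
    finally show ?thesis .
  qed
  have sum_bound: "trunc_norm K ((\<Sum>n<M. Q ^ n) * inverse P) \<le> 4 * C / d" for K M
  proof -
    have "trunc_norm K ((\<Sum>n<M. Q ^ n) * inverse P) \<le> (\<Sum>n<M. (1 / 2) ^ n * (2 / d * C))"
    proof (induction M)
      case (Suc M)
      have "trunc_norm K ((\<Sum>n<Suc M. Q ^ n) * inverse P)
          \<le> trunc_norm K ((\<Sum>n<M. Q ^ n) * inverse P) + trunc_norm K (Q ^ M * inverse P)"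
        by (simp add: distrib_right trunc_norm_add)
      then show ?case using Suc bound[of K M 1] by simp
    qed (simp add: trunc_norm_def)
    also have "\<dots> = (\<Sum>n<M. (1 / 2) ^ n) * (2 / d * C)" by (simp only: sum_distrib_right)
    also have "\<dots> \<le> (\<Sum>n. (1 / 2) ^ n) * (2 / d * C)"
      using C d by (intro mult_right_mono sum_le_suminf summable_geometric) auto
    also have "(\<Sum>n. (1 / 2 :: real) ^ n) = 2" by (subst suminf_geometric) auto
    finally show ?thesis by simp
  qed
  show ?thesis
    unfolding summable_norm_fps_iff_bounded
  proof (intro exI allI)
    fix K
    \<comment> \<open>For fixed K the number \<open>trunc_norm K (inverse F)\<close> is finite, so
      the remainder vanishes as M grows and leaves a bound free of K.\<close>
    have "trunc_norm K (inverse F) \<le> 4 * C / d + (1 / 2) ^ M * C * trunc_norm K (inverse F)" for M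
    proof -
      have "trunc_norm K (inverse F) \<le> trunc_norm K ((\<Sum>n<M. Q ^ n) * inverse P)
          + trunc_norm K (Q ^ M * inverse F)"
        using expand[of M] trunc_norm_add by metis
      moreover have "trunc_norm K (Q ^ M * inverse F) \<le> trunc_norm K (Q ^ M) * trunc_norm K (inverse F)"
        by (rule trunc_norm_mult)
      moreover have "trunc_norm K (Q ^ M) * trunc_norm K (inverse F)
          \<le> ((1 / 2) ^ M * C) * trunc_norm K (inverse F)"
        using bound[of K M 0] by (intro mult_right_mono trunc_norm_nonneg) auto
      ultimately show ?thesis using sum_bound[of K M] by linarith
    qed
    moreover have "(\<lambda>M. 4 * C / d + (1 / 2) ^ M * C * trunc_norm K (inverse F))
        \<longlonglongrightarrow> 4 * C / d + 0 * C * trunc_norm K (inverse F)"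
      by (intro tendsto_intros LIMSEQ_power_zero) auto
    ultimately show "trunc_norm K (inverse F) \<le> 4 * C / d"
      using LIMSEQ_le_const[of _ "4 * C / d"] by auto
  qed
qed

section \<open>Power series of \<open>(1 - w)\<^sup>c\<close>\<close>

text \<open>The binomial series of (1 - w)^c. The coefficient type is left generic: signs and
  asymptotics are studied over the reals, evaluation over the complex numbers.\<close>

definition fps_one_minus_powr :: "'a :: field_char_0 \<Rightarrow> 'a fps" where
  "fps_one_minus_powr c = Abs_fps (\<lambda>n. (-1) ^ n * (c gchoose n))"

lemma fps_one_minus_powr_nth: "fps_one_minus_powr c $ n = (-1) ^ n * (c gchoose n)"
  by (simp add: fps_one_minus_powr_def)

lemma fps_one_minus_powr_nth_0 [simp]: "fps_one_minus_powr c $ 0 = 1"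
  by (simp add: fps_one_minus_powr_def)

lemma fps_one_minus_powr_0 [simp]: "fps_one_minus_powr 0 = 1"
  by (rule fps_ext) (simp add: fps_one_minus_powr_nth gbinomial_0_left)

lemma fps_one_minus_powr_add:
  "fps_one_minus_powr (c + d) = fps_one_minus_powr c * fps_one_minus_powr d"
proof (rule fps_ext)
  fix n
  have "fps_one_minus_powr (c + d) $ n = (-1) ^ n * (fps_binomial c * fps_binomial d) $ n"
    by (simp add: fps_one_minus_powr_nth fps_binomial_add_mult[symmetric])
  also have "\<dots> = (\<Sum>i=0..n. ((-1) ^ i * (c gchoose i)) * ((-1) ^ (n - i) * (d gchoose (n - i))))"
    unfolding fps_mult_nth sum_distrib_left
    by (intro sum.cong refl) (auto simp: power_add[symmetric] mult_ac)
  also have "\<dots> = (fps_one_minus_powr c * fps_one_minus_powr d) $ n"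
    by (simp add: fps_mult_nth fps_one_minus_powr_nth)
  finally show "fps_one_minus_powr (c + d) $ n = \<dots>" .
qed

lemma fps_one_minus_powr_1: "fps_one_minus_powr 1 = 1 - fps_X"
proof (rule fps_ext)
  fix n :: nat
  show "fps_one_minus_powr 1 $ n = (1 - fps_X) $ n"
    by (cases n; cases "n - 1")
      (auto simp: fps_one_minus_powr_nth gbinomial_pochhammer pochhammer_rec)
qed

lemma fps_one_minus_powr_2: "fps_one_minus_powr 2 = (1 - fps_X)\<^sup>2"
  using fps_one_minus_powr_add[of 1 1] by (simp add: fps_one_minus_powr_1 power2_eq_square)

text \<open>These are the weights of \<open>frac_sum\<close>: a fractional sum of order \<nu> is
  multiplication by (1 - w)^(-\<nu>).\<close>

lemma fps_one_minus_powr_eq_Gamma: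
  fixes \<nu> :: real
  assumes "\<nu> > 0"
  shows "fps_one_minus_powr (- \<nu>) $ n = Gamma (real n + \<nu>) / (Gamma \<nu> * Gamma (real n + 1))"
proof -
  have "\<nu> \<notin> \<int>\<^sub>\<le>\<^sub>0" using assms by (auto elim!: nonpos_Ints_cases)
  then have "pochhammer \<nu> n = Gamma (\<nu> + real n) / Gamma \<nu>" by (rule pochhammer_Gamma)
  moreover have "fps_one_minus_powr (- \<nu>) $ n = pochhammer \<nu> n / fact n"
    by (simp add: fps_one_minus_powr_nth gbinomial_pochhammer power_add[symmetric] mult.assoc[symmetric])
  ultimately show ?thesis by (simp add: Gamma_fact add.commute)
qed

text \<open>Partial sums correspond to division by 1 - w, which lowers the exponent by one.\<close>

lemma fps_one_minus_powr_sum: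
  "(\<Sum>k\<le>n. fps_one_minus_powr c $ k) = fps_one_minus_powr (c - 1) $ n"
  using gbinomial_sum_lower_neg[of c n] by (simp add: fps_one_minus_powr_nth mult.commute)

lemma fps_one_minus_powr_nonneg:
  fixes c :: real
  assumes "c \<le> 0"
  shows "fps_one_minus_powr c $ n \<ge> 0"
proof -
  have "fps_one_minus_powr c $ n = pochhammer (- c) n / fact n"
    by (simp add: fps_one_minus_powr_nth gbinomial_pochhammer power_add[symmetric] mult.assoc[symmetric])
  also have "\<dots> \<ge> 0" using assms by (auto simp: pochhammer_prod intro!: divide_nonneg_nonneg prod_nonneg)
  finally show ?thesis .
qed

text \<open>The n-th coefficient behaves like n^(-c - 1) / Gamma(-c), and -c - 1 < 0. At c = 0 the
  quotient 1 / Gamma(0) is 0 by convention, in accordance with the series 1.\<close>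

lemma fps_one_minus_powr_tendsto_0:
  fixes c :: real
  assumes "-1 < c" "c \<le> 0"
  shows "(\<lambda>n. fps_one_minus_powr c $ n) \<longlonglongrightarrow> 0"
proof -
  have lim: "(\<lambda>n. (c gchoose n) / ((-1) ^ n / exp ((c + 1) * ln (real n)))) \<longlonglongrightarrow> inverse (Gamma (- c))"
    using gbinomial_asymptotic[of c] by simp
  have "(\<lambda>n. exp (- ((c + 1) * ln (real n)))) \<longlonglongrightarrow> 0"
    by (rule filterlim_compose[OF exp_at_bot])
      (use assms in \<open>simp add: filterlim_uminus_at_bot filterlim_compose[OF ln_at_top filterlim_real_sequentially]
        filterlim_tendsto_pos_mult_at_top[OF tendsto_const]\<close>)
  moreover have "fps_one_minus_powr c $ n =
      (c gchoose n) / ((-1) ^ n / exp ((c + 1) * ln (real n))) * exp (- ((c + 1) * ln (real n)))" for n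
    by (cases "even n") (simp_all add: fps_one_minus_powr_nth exp_minus)
  ultimately show ?thesis using tendsto_mult[OF lim, of _ 0] by (simp only: mult_zero_right)
qed

text \<open>All coefficients after the constant 1 are nonpositive, so their absolute values add up
  to 1 minus a partial sum of the series. That partial sum is a coefficient of (1 - w)^(c - 1),
  hence nonnegative.\<close>

lemma summable_fps_one_minus_powr_aux:
  fixes c :: real
  assumes "0 < c" "c \<le> 1"
  shows "summable (\<lambda>n. norm (fps_one_minus_powr c $ n))"
proof -
  have nonpos: "fps_one_minus_powr c $ Suc n \<le> 0" for n
  proof -
    have "fps_one_minus_powr c $ Suc n = - (c / real (Suc n)) * fps_one_minus_powr (c - 1) $ n"
      by (simp add: fps_one_minus_powr_nth gbinomial_absorption')
    then show ?thesis
      using fps_one_minus_powr_nonneg[of "c - 1" n] assms by (simp add: divide_nonneg_nonneg)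
  qed
  have "summable (\<lambda>n. norm (fps_one_minus_powr c $ Suc n))"
  proof (rule summableI_nonneg_bounded[where x = 1])
    fix n
    have "(\<Sum>i<n. norm (fps_one_minus_powr c $ Suc i)) = 1 - (\<Sum>i<Suc n. fps_one_minus_powr c $ i)"
      using nonpos by (subst sum.lessThan_Suc_shift) (simp add: sum_negf[symmetric])
    also have "\<dots> \<le> 1"
      using fps_one_minus_powr_nonneg[of "c - 1" n] assms
      by (simp add: lessThan_Suc_atMost fps_one_minus_powr_sum del: sum.lessThan_Suc)
    finally show "(\<Sum>i<n. norm (fps_one_minus_powr c $ Suc i)) \<le> 1" .
  qed auto
  then show ?thesis by (subst summable_Suc_iff[symmetric])
qed

text \<open>For 1 < c \<le> 2 the series is the square of the one for c / 2, and absolute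
  summability is stable under products.\<close>

lemma summable_fps_one_minus_powr:
  fixes c :: real
  assumes "0 < c" "c \<le> 2"
  shows "summable (\<lambda>n. norm (fps_one_minus_powr c $ n))"
proof (cases "c \<le> 1")
  case False
  have "summable (\<lambda>n. norm ((fps_one_minus_powr (c / 2) * fps_one_minus_powr (c / 2)) $ n))"
    by (intro summable_norm_fps_mult summable_fps_one_minus_powr_aux) (use assms in auto)
  then show ?thesis by (simp add: fps_one_minus_powr_add[symmetric])
qed (use assms summable_fps_one_minus_powr_aux in auto)

section \<open>Passage from real to complex coefficients, evaluation and convergence radius\<close>

definition fps_of_real :: "real fps \<Rightarrow> complex fps" where
  "fps_of_real F = Abs_fps (\<lambda>n. of_real (F $ n))"

lemma fps_of_real_nth [simp]: "fps_of_real F $ n = of_real (F $ n)"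
  by (simp add: fps_of_real_def)

lemma fps_of_real_mult: "fps_of_real (F * G) = fps_of_real F * fps_of_real G"
  by (rule fps_ext) (simp add: fps_mult_nth)

lemma fps_of_real_add: "fps_of_real (F + G) = fps_of_real F + fps_of_real G"
  and fps_of_real_diff: "fps_of_real (F - G) = fps_of_real F - fps_of_real G"
  and fps_of_real_const [simp]: "fps_of_real (fps_const c) = fps_const (of_real c)"
  and fps_of_real_1 [simp]: "fps_of_real 1 = 1"
  and fps_of_real_X [simp]: "fps_of_real fps_X = fps_X"
  by (rule fps_ext; simp)+

lemma fps_of_real_inverse:
  assumes "F $ 0 \<noteq> 0"
  shows "fps_of_real (inverse F) = inverse (fps_of_real F)"
proof -
  have "fps_of_real (inverse F) * fps_of_real F = 1"
    using inverse_mult_eq_1[OF assms] by (simp add: fps_of_real_mult[symmetric])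
  then show ?thesis
    using fps_inverse_unique[of "fps_of_real F" "fps_of_real (inverse F)"] by (simp add: mult.commute)
qed

lemma fps_of_real_one_minus_powr: "fps_of_real (fps_one_minus_powr c) = fps_one_minus_powr (of_real c)"
  by (rule fps_ext) (simp add: fps_one_minus_powr_nth gbinomial_prod_rev)

lemma sums_fps_one_minus_powr:
  fixes c w :: complex
  assumes "norm w < 1"
  shows "(\<lambda>n. fps_one_minus_powr c $ n * w ^ n) sums (1 - w) powr c"
  using gen_binomial_complex[of "- w" c] assms
  by (simp add: fps_one_minus_powr_nth power_minus[of w] mult_ac)

lemma eval_fps_one_minus_powr:
  fixes c w :: complex
  assumes "norm w < 1"
  shows "eval_fps (fps_one_minus_powr c) w = (1 - w) powr c"
  using sums_fps_one_minus_powr[OF assms, of c] by (simp add: eval_fps_def sums_iff)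

lemma fps_conv_radius_one_minus_powr:
  fixes c :: complex
  shows "fps_conv_radius (fps_one_minus_powr c) \<ge> 1"
  unfolding fps_conv_radius_def
proof (rule conv_radius_geI_ex')
  fix r :: real assume "0 < r" "ereal r < 1"
  then show "summable (\<lambda>n. fps_one_minus_powr c $ n * of_real r ^ n)"
    using sums_summable[OF sums_fps_one_minus_powr[of "of_real r" c]] by simp
qed

text \<open>A solution that tends to 0 is known to be bounded but not summable; this lets its
  generating function be evaluated in the open disc.\<close>

lemma fps_conv_radius_ge_1I:
  fixes F :: "complex fps"
  assumes "\<And>n. norm (F $ n) \<le> B"
  shows "fps_conv_radius F \<ge> 1"
  unfolding fps_conv_radius_def
proof (rule conv_radius_geI_ex')
  fix r :: real assume r: "0 < r" "ereal r < 1"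
  show "summable (\<lambda>n. F $ n * of_real r ^ n)"
  proof (rule summable_comparison_test'[of "\<lambda>n. B * r ^ n" 0])
    show "summable (\<lambda>n. B * r ^ n)" using r by (intro summable_mult summable_geometric) auto
    fix n show "norm (F $ n * of_real r ^ n) \<le> B * r ^ n"
      using r assms by (auto simp: norm_mult norm_power intro!: mult_right_mono)
  qed
qed

section \<open>Winding numbers and zeros in the disc\<close>

text \<open>Near t the difference L s - L t is the principal logarithm of g s / g t: continuity
  keeps its imaginary part below 1 < pi in absolute value, which selects the branch.\<close>

lemma continuous_log_has_vector_derivative:
  fixes g L :: "real \<Rightarrow> complex"
  assumes g: "(g has_vector_derivative g') (at t)"
    and L: "isCont L t"
    and eq: "\<And>s. s \<in> S \<Longrightarrow> exp (L s) = g s"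
    and S: "open S" "t \<in> S"
  shows "(L has_vector_derivative g' / g t) (at t)"
proof -
  have gt: "g t = exp (L t)" using eq S by simp
  have "((\<lambda>s. L t + Ln (g s / g t)) has_vector_derivative 0 + g' / g t) (at t)"
  proof (rule has_vector_derivative_add[OF has_vector_derivative_const])
    have "((\<lambda>s. g s / g t) has_vector_derivative g' / g t) (at t)"
      using has_vector_derivative_divide[OF g] by simp
    from field_vector_diff_chain_at[OF this, of Ln "inverse 1"]
    show "((\<lambda>s. Ln (g s / g t)) has_vector_derivative g' / g t) (at t)"
      using has_field_derivative_Ln[of 1] gt by (simp add: o_def)
  qed
  then have "((\<lambda>s. L t + Ln (g s / g t)) has_vector_derivative g' / g t) (at t)" by simp
  moreover have "eventually (\<lambda>s. L s = L t + Ln (g s / g t)) (nhds t)"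
  proof -
    have "eventually (\<lambda>s. dist (L s) (L t) < 1) (nhds t)"
      using tendstoD[OF L[unfolded isCont_def tendsto_at_iff_tendsto_nhds], of 1] by simp
    moreover have "eventually (\<lambda>s. s \<in> S) (nhds t)" using S by (rule eventually_nhds_in_open)
    ultimately show ?thesis
    proof eventually_elim
      case (elim s)
      have "\<bar>Im (L s - L t)\<bar> < 1"
        using elim(1) abs_Im_le_cmod[of "L s - L t"] by (auto simp: dist_norm)
      then have "Ln (exp (L s - L t)) = L s - L t"
        using pi_gt3 by (intro Ln_exp) auto
      then show ?case using eq[OF elim(2)] gt by (simp add: exp_diff)
    qed
  qed
  ultimately show ?thesis
    using gt by (subst has_vector_derivative_cong_ev[where g = "\<lambda>s. L t + Ln (g s / g t)"]) auto
qed

text \<open>By the argument principle the winding number counts the zeros inside radius r with their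
  orders. Orders are positive, so the count vanishes only if there is no zero there, and the annulus
  up to radius 1 contains none.\<close>

lemma winding_number_holomorphic_circle:
  fixes f :: "complex \<Rightarrow> complex"
  assumes hol: "f holomorphic_on ball 0 1"
    and r: "0 < r" "r < 1"
    and nz: "\<And>w. r \<le> norm w \<Longrightarrow> norm w < 1 \<Longrightarrow> f w \<noteq> 0"
  shows "winding_number (f \<circ> circlepath 0 r) 0 = 0 \<longleftrightarrow> (\<forall>w\<in>ball 0 1. f w \<noteq> 0)"
proof -
  define Z where "Z = {w \<in> ball 0 1. f w = 0}"
  have img: "path_image (circlepath 0 r) \<subseteq> ball (0::complex) 1" using r by auto
  have nz_circ: "f w \<noteq> 0" if "w \<in> path_image (circlepath 0 r)" for w
    using that r nz[of w] by auto
  have Z_norm: "norm w < r" if "w \<in> Z" for w using that nz[of w] by (force simp: Z_def)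
  \<comment> \<open>A point where f is nonzero excludes f = 0, so the zeros are finite in number and
    of finite order.\<close>
  define w1 :: complex where "w1 = of_real r"
  have w1: "w1 \<in> ball 0 1" "f w1 \<noteq> 0" using r nz[of w1] by (auto simp: w1_def)
  have fin: "finite Z"
  proof (cases "f constant_on ball 0 1")
    case True
    then have "Z = {}" using w1 unfolding constant_on_def Z_def by (metis (mono_tags, lifting) Collect_empty_eq)
    then show ?thesis by simp
  next
    case False
    have "finite {w \<in> cball 0 r. f w = 0}"
      by (rule holomorphic_compact_finite_zeros[OF hol _ _ _ _ False]) (use r in auto)
    then show ?thesis by (rule finite_subset[rotated]) (use Z_norm in \<open>force simp: Z_def\<close>)
  qed
  have zorder_pos: "zorder f w > 0" if "w \<in> Z" for w
    using zorder_exist_zero[OF hol, of w] that w1 unfolding Z_def by (metis (mono_tags, lifting) mem_Collect_eq open_ball connected_ball)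
  have "winding_number (f \<circ> circlepath 0 r) 0
      = 1 / (2 * pi * \<i>) * contour_integral (f \<circ> circlepath 0 r) (\<lambda>w. 1 / (w - 0))"
  proof (rule winding_number_valid_path)
    show "valid_path (f \<circ> circlepath 0 r)"
      by (rule valid_path_compose_holomorphic[OF _ hol]) (use img in auto)
    show "0 \<notin> path_image (f \<circ> circlepath 0 r)"
      using nz_circ by (auto simp: path_image_compose)
  qed
  also have "contour_integral (f \<circ> circlepath 0 r) (\<lambda>w. 1 / (w - 0))
      = contour_integral (circlepath 0 r) (\<lambda>w. deriv f w * (1 / (f w - 0)))"
    by (rule contour_integral_comp_analyticW[of _ "ball 0 1"])
      (use img hol in \<open>auto simp: analytic_on_open\<close>)
  \<comment> \<open>The shape that \<open>argument_principle\<close> expects, with weight function 1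
    and an empty set of poles.\<close>
  also have "\<dots> = contour_integral (circlepath 0 r) (\<lambda>w. deriv f w * 1 / f w)"
    by simp
  also have "\<dots> = 2 * pi * \<i> * (\<Sum>p\<in>{w \<in> ball 0 1. f w = 0 \<or> w \<in> {}}.
      winding_number (circlepath 0 r) p * 1 * zorder f p)"
  proof (rule argument_principle)
    show "path_image (circlepath 0 r) \<subseteq> ball 0 1 - {w \<in> ball 0 1. f w = 0 \<or> w \<in> {}}"
      using img nz_circ by blast
    show "\<forall>z. z \<notin> ball 0 1 \<longrightarrow> winding_number (circlepath 0 r) z = 0"
      using winding_number_zero_outside[OF _ convex_ball _ _ img] by auto
    show "finite {w \<in> ball 0 1. f w = 0 \<or> w \<in> {}}" using fin by (simp add: Z_def)
  qed (use hol in auto)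
  also have "{w \<in> ball 0 1. f w = 0 \<or> w \<in> {}} = Z" by (simp add: Z_def)
  also have "(\<Sum>p\<in>Z. winding_number (circlepath 0 r) p * 1 * zorder f p) = (\<Sum>p\<in>Z. of_int (zorder f p))"
    by (intro sum.cong refl) (use Z_norm in \<open>simp add: winding_number_circlepath\<close>)
  finally have "winding_number (f \<circ> circlepath 0 r) 0 = of_int (\<Sum>p\<in>Z. zorder f p)"
    by (simp del: o_apply)
  also have "\<dots> = 0 \<longleftrightarrow> (\<Sum>p\<in>Z. zorder f p) = 0" by (simp only: of_int_eq_0_iff)
  also have "\<dots> \<longleftrightarrow> (\<forall>p\<in>Z. zorder f p = 0)"
    by (rule sum_nonneg_eq_0_iff[OF fin]) (use zorder_pos in \<open>auto intro: less_imp_le\<close>)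
  also have "\<dots> \<longleftrightarrow> Z = {}" using zorder_pos by fastforce
  also have "\<dots> \<longleftrightarrow> (\<forall>w\<in>ball 0 1. f w \<noteq> 0)" by (auto simp: Z_def)
  finally show ?thesis .
qed

text \<open>On the circle f is only continuous. Its zeros form a compact set inside the open disc,
  so some annulus r \<le> norm w \<le> 1 is free of them, and shrinking the loop radially inside it
  reaches the domain of holomorphy.\<close>

theorem winding_number_unit_circle_eq_0_iff:
  fixes f :: "complex \<Rightarrow> complex"
  assumes hol: "f holomorphic_on ball 0 1"
    and cont: "continuous_on (cball 0 1) f"
    and nz: "\<And>w. norm w = 1 \<Longrightarrow> f w \<noteq> 0"
  shows "winding_number (f \<circ> circlepath 0 1) 0 = 0 \<longleftrightarrow> (\<forall>w\<in>ball 0 1. f w \<noteq> 0)"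
proof -
  obtain r where r: "0 < r" "r < 1" "\<And>w. r \<le> norm w \<Longrightarrow> norm w \<le> 1 \<Longrightarrow> f w \<noteq> 0"
  proof (cases "{w \<in> cball 0 1. f w = 0} = {}")
    case True
    then show ?thesis using that[of "1/2"] by auto
  next
    case False
    have "closed {w \<in> cball 0 1. f w = 0}"
      by (rule continuous_closed_preimage_constant[OF cont closed_cball])
    moreover have "bounded {w \<in> cball 0 1. f w = 0}"
      by (rule bounded_subset[OF bounded_cball[of 0 1]]) auto
    ultimately have "compact {w \<in> cball 0 1. f w = 0}" by (simp add: compact_eq_bounded_closed)
    then obtain w0 where w0: "w0 \<in> cball 0 1" "f w0 = 0"
      "\<And>w. w \<in> cball 0 1 \<Longrightarrow> f w = 0 \<Longrightarrow> norm w \<le> norm w0"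
      using continuous_attains_sup[OF _ False continuous_on_norm[OF continuous_on_id]] by fastforce
    have "norm w0 < 1" using w0 nz[of w0] by force
    show ?thesis
      \<comment> \<open>Halfway between the largest modulus of a zero and 1.\<close>
      by (rule that[of "(1 + norm w0) / 2"])
        (use \<open>norm w0 < 1\<close> w0(3) in \<open>force simp: add_pos_nonneg\<close>)+
  qed
  have "homotopic_loops (-{0}) (f \<circ> circlepath 0 r) (f \<circ> circlepath 0 1)"
  proof -
    have "homotopic_loops {w. r \<le> norm w \<and> norm w \<le> 1} (circlepath 0 r) (circlepath 0 1)"
    proof (rule homotopic_loops_linear)
      fix t :: real assume "t \<in> {0..1}"
      show "closed_segment (circlepath 0 r t) (circlepath 0 1 t) \<subseteq> {w. r \<le> norm w \<and> norm w \<le> 1}"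
      proof
        fix w assume "w \<in> closed_segment (circlepath 0 r t) (circlepath 0 1 t)"
        then obtain u where u: "0 \<le> u" "u \<le> 1"
          "w = (1 - u) *\<^sub>R circlepath 0 r t + u *\<^sub>R circlepath 0 1 t"
          by (auto simp: in_segment)
        define c where "c = exp (2 * of_real pi * \<i> * of_real t)"
        have "w = of_real ((1 - u) * r + u) * c"
          by (simp add: u(3) circlepath c_def scaleR_conv_of_real algebra_simps)
        moreover have "norm c = 1" by (simp add: c_def)
        ultimately have "norm w = \<bar>(1 - u) * r + u\<bar>"
          by (simp only: norm_mult norm_of_real mult_1_right)
        moreover have "(1 - u) * r + u = r + u * (1 - r)" "(1 - u) * r + u = 1 - (1 - u) * (1 - r)"
          by (simp_all add: algebra_simps)
        moreover have "u * (1 - r) \<ge> 0" "(1 - u) * (1 - r) \<ge> 0" using u r by auto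
        ultimately show "w \<in> {w. r \<le> norm w \<and> norm w \<le> 1}" using r by auto
      qed
    qed auto
    then show ?thesis
      by (rule homotopic_loops_continuous_image)
        (use r(3) in \<open>auto intro: continuous_on_subset[OF cont]\<close>)
  qed
  then have "winding_number (f \<circ> circlepath 0 1) 0 = winding_number (f \<circ> circlepath 0 r) 0"
    by (rule winding_number_homotopic_loops[symmetric])
  with winding_number_holomorphic_circle[OF hol r(1,2)] r(3) show ?thesis by simp
qed

section \<open>The curve and the characteristic function\<close>

definition char_fun :: "real \<Rightarrow> real \<Rightarrow> real \<Rightarrow> real \<Rightarrow> complex \<Rightarrow> complex" where
  "char_fun \<alpha> \<beta> a b w =
     (1 - w) powr of_real \<alpha> + of_real a * w * (1 - w) powr of_real \<beta> - of_real (b - 1) * w\<^sup>2"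

lemma one_minus_notin_nonpos_Reals:
  fixes w :: complex
  assumes "norm w \<le> 1" "w \<noteq> 1"
  shows "1 - w \<notin> \<real>\<^sub>\<le>\<^sub>0"
proof
  assume "1 - w \<in> \<real>\<^sub>\<le>\<^sub>0"
  then obtain x where x: "1 - w = of_real x" "x \<le> 0" by (auto elim: nonpos_Reals_cases)
  then have "w = of_real (1 - x)" by (simp add: algebra_simps)
  with assms x(2) show False by (simp del: of_real_diff)
qed

text \<open>The cut of the principal powers is the ray of real w \<ge> 1, which meets the closed
  disc only in 1. Differentiability at the other points of the circle is what differentiates the
  curve on the open parameter interval.\<close>

lemma char_fun_has_field_derivative:
  assumes "norm w \<le> 1" "w \<noteq> 1"
  obtains d where "(char_fun \<alpha> \<beta> a b has_field_derivative d) (at w)"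
proof -
  have "char_fun \<alpha> \<beta> a b field_differentiable (at w)"
    unfolding char_fun_def[abs_def] field_differentiable_def
    by (rule exI, (rule derivative_intros one_minus_notin_nonpos_Reals[OF assms] refl)+)
  then show ?thesis using that by (auto simp: field_differentiable_def)
qed

lemma char_fun_holomorphic: "char_fun \<alpha> \<beta> a b holomorphic_on ball 0 1"
  unfolding char_fun_def by (intro holomorphic_intros one_minus_notin_nonpos_Reals) auto

text \<open>1 - w stays in the closed right half plane, where principal powers with positive
  exponent are continuous even at 0, that is at the branch point w = 1.\<close>

lemma char_fun_continuous:
  assumes "0 < \<alpha>" "0 < \<beta>"
  shows "continuous_on (cball 0 1) (char_fun \<alpha> \<beta> a b)"
  unfolding char_fun_def
proof (intro continuous_intros)
  have "Re (1 - z) \<ge> 0" if "z \<in> cball 0 1" for z :: complex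
    using that complex_Re_le_cmod[of z] by (auto intro: order.trans)
  then show "cball 0 1 \<subseteq> {z :: complex. 0 \<le> Re (1 - z) \<or> Im (1 - z) \<noteq> 0}"
    "cball 0 1 \<subseteq> {z :: complex. 0 \<le> Re (1 - z) \<or> Im (1 - z) \<noteq> 0}" by blast+
qed (use assms in auto)

text \<open>1 - exp(-i \<theta>) = 2 sin(\<theta>/2) exp(i (pi/2 - \<theta>/2)), where the angle
  lies in [-pi/2, pi/2] and so selects the principal power. At both ends of the interval the two
  sides are 0.\<close>

lemma one_minus_cis_powr:
  assumes "0 \<le> \<theta>" "\<theta> \<le> 2 * pi" "c > 0"
  shows "(1 - exp (- \<i> * of_real \<theta>)) powr of_real c =
    of_real (2 powr c * sin (\<theta> / 2) powr c) * exp (\<i> * of_real (c * (pi / 2 - \<theta> / 2)))"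
proof (cases "\<theta> = 0 \<or> \<theta> = 2 * pi")
  case True
  then have "exp (- \<i> * of_real \<theta>) = 1" "sin (\<theta> / 2) = 0"
    by (auto simp: exp_minus mult.commute)
  then show ?thesis by simp
next
  case False
  with assms have s: "sin (\<theta> / 2) > 0" by (intro sin_gt_zero) auto
  define r where "r = 2 * sin (\<theta> / 2)"
  define v where "v = pi / 2 - \<theta> / 2"
  have r: "r > 0" using s by (simp add: r_def)
  have "1 - exp (- \<i> * of_real \<theta>) = of_real r * exp (\<i> * of_real v)"
  proof -
    have c: "cos \<theta> = 1 - 2 * (sin (\<theta> / 2))\<^sup>2" using cos_double_sin[of "\<theta> / 2"] by simp
    have d: "sin \<theta> = 2 * sin (\<theta> / 2) * cos (\<theta> / 2)" using sin_double[of "\<theta> / 2"] by simp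
    have "exp (- \<i> * of_real \<theta>) = cis (- \<theta>)" "exp (\<i> * of_real v) = cis v"
      by (simp_all add: cis_conv_exp)
    then show ?thesis
      by (simp add: complex_eq_iff r_def v_def cos_diff sin_diff c d power2_eq_square)
  qed
  then have "Ln (1 - exp (- \<i> * of_real \<theta>)) = Ln (exp (of_real (ln r) + \<i> * of_real v))"
    using r by (simp add: exp_add exp_of_real)
  also have "\<dots> = of_real (ln r) + \<i> * of_real v"
    by (rule Ln_exp) (use assms pi_gt_zero in \<open>simp_all add: v_def field_simps del: pi_gt_zero\<close>)
  finally have "(1 - exp (- \<i> * of_real \<theta>)) powr of_real c =
      exp (of_real c * (of_real (ln r) + \<i> * of_real v))"
    using \<open>1 - _ = _\<close> r by (simp add: powr_def)
  also have "\<dots> = of_real (exp (c * ln r)) * exp (\<i> * of_real (c * v))"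
    by (simp add: exp_of_real[symmetric] exp_add[symmetric] algebra_simps)
  also have "exp (c * ln r) = 2 powr c * sin (\<theta> / 2) powr c"
    using r s by (simp add: powr_mult[symmetric] r_def[symmetric]) (simp add: powr_def)
  finally show ?thesis by (simp add: v_def)
qed

text \<open>With w = exp(-i \<theta>), the factor w^(-2) adds 2\<theta> to the phase of the first
  term, leaves \<theta> in that of the second, and turns -(b - 1) w^2 into 1 - b, the source of the
  constant 1 in \<open>gamma_curve\<close>.\<close>

lemma gamma_curve_eq_char_fun:
  assumes "0 \<le> \<theta>" "\<theta> \<le> 2 * pi" "\<alpha> > 0" "\<beta> > 0"
  shows "gamma_curve \<alpha> \<beta> a \<theta> - of_real b =
    exp (2 * \<i> * of_real \<theta>) * char_fun \<alpha> \<beta> a b (exp (- \<i> * of_real \<theta>))"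
proof -
  define e where "e x = exp (\<i> * of_real x)" for x
  have e_add: "e x * e y = e (x + y)" for x y
    by (simp add: e_def exp_add[symmetric] algebra_simps)
  have e0: "e 0 = 1" by (simp add: e_def)
  have w: "exp (- \<i> * of_real \<theta>) = e (- \<theta>)" "exp (2 * \<i> * of_real \<theta>) = e (2 * \<theta>)"
    by (simp_all add: e_def algebra_simps)
  have "e (2 * \<theta>) * char_fun \<alpha> \<beta> a b (e (- \<theta>)) =
     of_real (2 powr \<alpha> * sin (\<theta> / 2) powr \<alpha>) * (e (2 * \<theta>) * e (\<alpha> * (pi / 2 - \<theta> / 2))) +
     of_real (a * 2 powr \<beta> * sin (\<theta> / 2) powr \<beta>) * (e (2 * \<theta>) * e (- \<theta>) * e (\<beta> * (pi / 2 - \<theta> / 2)))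
     - of_real (b - 1) * (e (2 * \<theta>) * e (- \<theta>) * e (- \<theta>))"
    using one_minus_cis_powr[OF assms(1,2), of \<alpha>] one_minus_cis_powr[OF assms(1,2), of \<beta>] assms
    unfolding char_fun_def w e_def[symmetric] by (simp add: algebra_simps power2_eq_square)
  also have "\<dots> = gamma_curve \<alpha> \<beta> a \<theta> - of_real b"
    unfolding e_add gamma_curve_def by (simp add: e_def algebra_simps)
  finally show ?thesis using w by simp
qed

lemma char_fun_nonzero_on_circle:
  assumes "of_real b \<notin> gamma_curve \<alpha> \<beta> a ` {0..2 * pi}" "\<alpha> > 0" "\<beta> > 0" "norm w = 1"
  shows "char_fun \<alpha> \<beta> a b w \<noteq> 0"
proof
  assume 0: "char_fun \<alpha> \<beta> a b w = 0"
  \<comment> \<open>The conjugate is parametrized because the curve corresponds to w = exp(-i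
    t).\<close>
  obtain t where t: "0 \<le> t" "t < 2 * pi" "cnj w = cis t"
    using complex_unimodular_polar[of "cnj w"] assms(4) by (auto simp: cis.ctr complex_eq_iff)
  have "w = cnj (cis t)" by (simp add: t(3)[symmetric])
  then have "w = exp (- \<i> * of_real t)" using cis_conv_exp[of "- t"] by (simp add: cis_cnj)
  with gamma_curve_eq_char_fun[of t \<alpha> \<beta> a b] 0 t assms have "gamma_curve \<alpha> \<beta> a t = of_real b" by simp
  with t assms(1) show False by (metis atLeastAtMost_iff imageI less_imp_le)
qed

lemma Ind_gamma_curve:
  assumes "of_real b \<notin> gamma_curve \<alpha> \<beta> a ` {0..2 * pi}" "\<alpha> > 0" "\<beta> > 0"
  shows "Ind (gamma_curve \<alpha> \<beta> a) (of_real b) =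
    2 - winding_number (char_fun \<alpha> \<beta> a b \<circ> circlepath 0 1) 0"
proof -
  let ?D = "char_fun \<alpha> \<beta> a b" and ?g = "gamma_curve \<alpha> \<beta> a"
  define p where "p = ?D \<circ> circlepath 0 1"
  have "path p" unfolding p_def
    by (rule path_continuous_image) (auto intro: continuous_on_subset[OF char_fun_continuous] assms)
  moreover have "0 \<notin> path_image p"
    unfolding p_def path_image_compose using char_fun_nonzero_on_circle[OF assms] by auto
  ultimately obtain q where q: "path q"
    "pathfinish q - pathstart q = 2 * of_real pi * \<i> * winding_number p 0"
    "\<And>t. t \<in> {0..1} \<Longrightarrow> p t = 0 + exp (q t)"
    using winding_number_as_continuous_log by blast
  \<comment> \<open>A continuous logarithm of the curve minus b: 2 i \<theta> belongs to w^(-2), and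
    q is a logarithm of D along the circle. The reversed parameter reflects that exp(-i \<theta>)
    runs clockwise, and it makes the winding number enter with a minus sign.\<close>
  define L where "L \<theta> = 2 * \<i> * of_real \<theta> + q (1 - \<theta> / (2 * pi))" for \<theta>
  have L_exp: "exp (L \<theta>) = ?g \<theta> - of_real b" if "\<theta> \<in> {0..2 * pi}" for \<theta>
  proof -
    have "1 - \<theta> / (2 * pi) \<in> {0..1}" using that by (auto simp: field_simps)
    from q(3)[OF this] have "exp (q (1 - \<theta> / (2 * pi))) = ?D (circlepath 0 1 (1 - \<theta> / (2 * pi)))"
      by (simp add: p_def)
    also have "circlepath 0 1 (1 - \<theta> / (2 * pi)) = exp (- \<i> * of_real \<theta>)"
    proof -
      have "2 * of_real pi * \<i> * of_real (1 - \<theta> / (2 * pi)) = 2 * of_real pi * \<i> + - \<i> * of_real \<theta>"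
        by (simp add: field_simps)
      then show ?thesis by (simp add: circlepath exp_diff exp_minus inverse_eq_divide)
    qed
    finally show ?thesis
      using gamma_curve_eq_char_fun[of \<theta> \<alpha> \<beta> a b] that assms by (simp add: L_def exp_add)
  qed
  have L_cont: "continuous_on {0..2 * pi} L"
    unfolding L_def
    by (intro continuous_intros continuous_on_compose2[OF q(1)[unfolded path_def]])
      (auto simp: field_simps)
  have L_deriv: "(L has_vector_derivative vector_derivative ?g (at \<theta>) / (?g \<theta> - of_real b)) (at \<theta>)"
    if th: "\<theta> \<in> {0<..<2 * pi}" for \<theta>
  proof -
    have cis_ne: "exp (- \<i> * of_real \<theta>) \<noteq> 1"
    proof
      assume "exp (- \<i> * of_real \<theta>) = 1"
      then have "cis (- \<theta>) = 1" by (simp add: cis_conv_exp)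
      then have "cos \<theta> = 1" by (simp add: complex_eq_iff)
      then show False using th cos_double_sin[of "\<theta> / 2"] sin_gt_zero[of "\<theta> / 2"] by auto
    qed
    obtain d where d: "(?D has_field_derivative d) (at (exp (- \<i> * of_real \<theta>)))"
      by (rule char_fun_has_field_derivative[OF _ cis_ne]) simp
    have chain: "((\<lambda>z. ?D (exp (- \<i> * z))) has_field_derivative d * (exp (- \<i> * of_real \<theta>) * - \<i>))
        (at (of_real \<theta>))"
      by (rule DERIV_chain2[where f = ?D and g = "\<lambda>z. exp (- \<i> * z)", OF d])
        (auto intro!: derivative_eq_intros)
    have "((\<lambda>z. of_real b + exp (2 * \<i> * z) * ?D (exp (- \<i> * z))) has_field_derivative
        0 + (exp (2 * \<i> * of_real \<theta>) * (2 * \<i>) * ?D (exp (- \<i> * of_real \<theta>)) +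
         (d * (exp (- \<i> * of_real \<theta>) * - \<i>)) * exp (2 * \<i> * of_real \<theta>))) (at (of_real \<theta>))"
      (is "(_ has_field_derivative ?d) _")
      by (intro DERIV_add DERIV_mult DERIV_const chain)
        (auto intro!: derivative_eq_intros)
    then have "((\<lambda>t. of_real b + exp (2 * \<i> * of_real t) * ?D (exp (- \<i> * of_real t)))
        has_vector_derivative ?d) (at \<theta>)"
      by (rule has_vector_derivative_real_field)
    then have "(?g has_vector_derivative ?d) (at \<theta>)"
    proof (rule has_vector_derivative_transform_within_open[OF _ open_greaterThanLessThan th])
      fix t assume "t \<in> {0<..<2 * pi}"
      then show "of_real b + exp (2 * \<i> * of_real t) * ?D (exp (- \<i> * of_real t)) = ?g t"
        using gamma_curve_eq_char_fun[of t \<alpha> \<beta> a b] assms by (simp add: algebra_simps)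
    qed
    then have "(?g has_vector_derivative vector_derivative ?g (at \<theta>)) (at \<theta>)"
      by (simp add: vector_derivative_at)
    then have "((\<lambda>t. ?g t - of_real b) has_vector_derivative vector_derivative ?g (at \<theta>)) (at \<theta>)"
      by (simp add: has_vector_derivative_diff_const)
    moreover have "isCont L \<theta>"
      using L_cont th by (intro continuous_on_interior) auto
    ultimately show ?thesis
      by (rule continuous_log_has_vector_derivative[where S = "{0<..<2 * pi}"])
        (use L_exp th in auto)
  qed
  \<comment> \<open>Continuity of \<open>L\<close> up to the endpoints suffices, so the blow-up of the derivative there is harmless.\<close>
  have "((\<lambda>\<theta>. vector_derivative ?g (at \<theta>) / (?g \<theta> - of_real b)) has_integral (L (2 * pi) - L 0)) {0..2 * pi}"
    by (rule fundamental_theorem_of_calculus_interior[OF _ L_cont L_deriv]) auto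
  then have "Ind ?g (of_real b) = 1 / (2 * of_real pi * \<i>) * (L (2 * pi) - L 0)"
    unfolding Ind_def by (simp add: integral_unique)
  also have "L (2 * pi) - L 0 = 2 * of_real pi * \<i> * (2 - winding_number p 0)"
    using q(2) by (simp add: L_def pathstart_def pathfinish_def algebra_simps)
  finally show ?thesis by (simp add: p_def)
qed

theorem Ind_gamma_curve_eq_2_iff:
  assumes "of_real b \<notin> gamma_curve \<alpha> \<beta> a ` {0..2 * pi}" "\<alpha> > 0" "\<beta> > 0"
  shows "Ind (gamma_curve \<alpha> \<beta> a) (of_real b) = 2 \<longleftrightarrow> (\<forall>w\<in>cball 0 1. char_fun \<alpha> \<beta> a b w \<noteq> 0)"
proof -
  have "Ind (gamma_curve \<alpha> \<beta> a) (of_real b) = 2 \<longleftrightarrow>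
      winding_number (char_fun \<alpha> \<beta> a b \<circ> circlepath 0 1) 0 = 0"
    by (simp add: Ind_gamma_curve[OF assms] del: o_apply)
  also have "\<dots> \<longleftrightarrow> (\<forall>w\<in>ball 0 1. char_fun \<alpha> \<beta> a b w \<noteq> 0)"
    by (rule winding_number_unit_circle_eq_0_iff[OF char_fun_holomorphic char_fun_continuous
          char_fun_nonzero_on_circle]) (use assms in auto)
  also have "\<dots> \<longleftrightarrow> (\<forall>w\<in>cball 0 1. char_fun \<alpha> \<beta> a b w \<noteq> 0)"
    using char_fun_nonzero_on_circle[OF assms] by (fastforce simp: le_less)
  finally show ?thesis .
qed

section \<open>Stability of the linearization\<close>

text \<open>Each fixed term F_i G_(n - i) tends to 0 as n grows and is dominated by
  \<open>norm (F $ i) * B\<close>, so Tannery's theorem applies.\<close>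

lemma fps_mult_nth_tendsto_0:
  fixes F G :: "'a :: {banach, real_normed_field} fps"
  assumes F: "summable (\<lambda>n. norm (F $ n))" and G: "(\<lambda>n. G $ n) \<longlonglongrightarrow> 0"
  shows "(\<lambda>n. (F * G) $ n) \<longlonglongrightarrow> 0"
proof -
  obtain B where B: "\<And>n. norm (G $ n) \<le> B"
    using convergent_imp_Bseq[of "\<lambda>n. G $ n"] G by (auto simp: convergent_def Bseq_def)
  \<comment> \<open>Padding with 0 turns the finite convolution into an infinite series over i and
    hides the truncated subtraction n - i.\<close>
  define h where "h n i = (if i \<le> n then F $ i * G $ (n - i) else 0)" for n i
  have "(\<lambda>n. \<Sum>i. h n i) \<longlonglongrightarrow> (\<Sum>i. 0)"
  proof (rule tannerys_theorem[where a = "\<lambda>i n. h n i" and M = "\<lambda>i. norm (F $ i) * B",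
        THEN conjunct2, THEN conjunct2])
    show "(\<lambda>n. h n i) \<longlonglongrightarrow> 0" for i
    proof (rule Lim_transform_eventually)
      have "filterlim (\<lambda>n. n - i) at_top sequentially" by (rule filterlim_minus_const_nat_at_top)
      from tendsto_mult_right_zero[OF filterlim_compose[OF G this]]
      show "(\<lambda>n. F $ i * G $ (n - i)) \<longlonglongrightarrow> 0" .
      show "\<forall>\<^sub>F n in sequentially. F $ i * G $ (n - i) = h n i"
        using eventually_ge_at_top[of i] by eventually_elim (simp add: h_def)
    qed
    have "norm (h n i) \<le> norm (F $ i) * B" for n i
      using B order.trans[OF norm_ge_zero B] by (auto simp: h_def norm_mult intro!: mult_left_mono)
    then show "\<forall>\<^sub>F (i, n) in at_top \<times>\<^sub>F sequentially. norm (h n i) \<le> norm (F $ i) * B"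
      by (auto intro: always_eventually)
    show "summable (\<lambda>i. norm (F $ i) * B)" by (intro summable_mult2 F)
  qed auto
  moreover have "(\<Sum>i. h n i) = (F * G) $ n" for n
  proof -
    have "(\<Sum>i. h n i) = (\<Sum>i\<in>{0..n}. h n i)" by (rule suminf_finite) (auto simp: h_def)
    also have "\<dots> = (F * G) $ n" unfolding fps_mult_nth by (intro sum.cong) (auto simp: h_def)
    finally show ?thesis .
  qed
  ultimately show ?thesis by simp
qed

section \<open>The linearization as an identity of formal power series\<close>

definition fps_of_seq :: "(real \<Rightarrow> real) \<Rightarrow> real fps" where
  "fps_of_seq y = Abs_fps (\<lambda>n. y (real n))"

lemma fps_of_seq_nth [simp]: "fps_of_seq y $ n = y (real n)"
  by (simp add: fps_of_seq_def)

text \<open>The convolution sum in \<open>frac_sum\<close> is a Cauchy product. Integer order fits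
  in, since the exponent is then 0 and the kernel is the series 1.\<close>

lemma caputo_diff_eq_fps_nth:
  assumes "0 < m" "real m - 1 < \<mu>" "\<mu> \<le> real m"
  shows "caputo_diff \<mu> y (real m - \<mu> + real n) =
    (fps_of_seq (fwd_diff m y) * fps_one_minus_powr (\<mu> - real m)) $ n"
proof -
  have "\<lceil>\<mu>\<rceil> = int m" using assms by linarith
  then have m: "nat \<lceil>\<mu>\<rceil> = m" by simp
  show ?thesis
  proof (cases "\<mu> = real m")
    case True
    then show ?thesis by (simp add: caputo_diff_def)
  next
    case False
    define \<nu> where "\<nu> = real m - \<mu>"
    have \<nu>: "\<nu> > 0" using False assms by (simp add: \<nu>_def)
    have "caputo_diff \<mu> y (real m - \<mu> + real n) = frac_sum \<nu> (fwd_diff m y) (\<nu> + real n)"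
      using False by (simp add: caputo_diff_def m \<nu>_def Let_def)
    also have "\<dots> = (\<Sum>s\<le>n. fps_of_seq (fwd_diff m y) $ s * fps_one_minus_powr (- \<nu>) $ (n - s))"
      unfolding frac_sum_def Let_def
      by (simp add: sum_distrib_left fps_one_minus_powr_eq_Gamma[OF \<nu>] of_nat_diff mult_ac divide_simps)
    also have "\<dots> = (fps_of_seq (fwd_diff m y) * fps_one_minus_powr (- \<nu>)) $ n"
      by (simp add: fps_mult_nth atLeast0AtMost)
    finally show ?thesis by (simp add: \<nu>_def)
  qed
qed

lemma fwd_diff_1: "fwd_diff (Suc 0) y t = y (t + 1) - y t"
  and fwd_diff_2: "fwd_diff 2 y t = y (t + 2) - 2 * y (t + 1) + y t"
  by (simp_all add: fwd_diff_def eval_nat_numeral)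

lemma fps_fwd_diff_1:
  "fps_X * fps_of_seq (fwd_diff 1 y) = (1 - fps_X) * fps_of_seq y - fps_const (y 0)"
proof (rule fps_ext)
  fix n
  show "(fps_X * fps_of_seq (fwd_diff 1 y)) $ n =
      ((1 - fps_X) * fps_of_seq y - fps_const (y 0)) $ n"
    by (cases n) (simp_all add: algebra_simps fwd_diff_1)
qed

text \<open>The second difference is the first difference of the first one; the two shifts by X lose
  the initial values y 0 and y 1 - y 0.\<close>

lemma fps_fwd_diff_2:
  "fps_X\<^sup>2 * fps_of_seq (fwd_diff 2 y) =
    (1 - fps_X)\<^sup>2 * fps_of_seq y - (fps_const (y 0) + fps_const (y 1 - 2 * y 0) * fps_X)"
proof -
  have "fps_X * fps_of_seq (fwd_diff 2 y) =
      (1 - fps_X) * fps_of_seq (fwd_diff 1 y) - fps_const (fwd_diff 1 y 0)"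
  proof (rule fps_ext)
    fix n
    show "(fps_X * fps_of_seq (fwd_diff 2 y)) $ n =
        ((1 - fps_X) * fps_of_seq (fwd_diff 1 y) - fps_const (fwd_diff 1 y 0)) $ n"
      by (cases n) (simp_all add: algebra_simps fwd_diff_1 fwd_diff_2)
  qed
  then have "fps_X\<^sup>2 * fps_of_seq (fwd_diff 2 y) =
      fps_X * ((1 - fps_X) * fps_of_seq (fwd_diff 1 y) - fps_const (fwd_diff 1 y 0))"
    by (simp only: power2_eq_square mult.assoc)
  also have "\<dots> = (1 - fps_X) * (fps_X * fps_of_seq (fwd_diff 1 y)) - fps_X * fps_const (fwd_diff 1 y 0)"
    by (simp add: algebra_simps)
  also have "\<dots> = (1 - fps_X) * ((1 - fps_X) * fps_of_seq y - fps_const (y 0)) - fps_X * fps_const (y 1 - y 0)"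
    unfolding fps_fwd_diff_1 unfolding One_nat_def fwd_diff_1 by simp
  also have "fps_const (y 1 - 2 * y 0) = fps_const (y 1 - y 0) - fps_const (y 0)" by simp
  then have "(1 - fps_X) * ((1 - fps_X) * fps_of_seq y - fps_const (y 0)) - fps_X * fps_const (y 1 - y 0) =
      (1 - fps_X)\<^sup>2 * fps_of_seq y - (fps_const (y 0) + fps_const (y 1 - 2 * y 0) * fps_X)"
    by (simp only:) (simp add: power2_eq_square algebra_simps del: fps_const_sub)
  finally show ?thesis .
qed

definition char_fps :: "real \<Rightarrow> real \<Rightarrow> real \<Rightarrow> real \<Rightarrow> real fps" where
  "char_fps \<alpha> \<beta> a b = fps_one_minus_powr \<alpha> + fps_const a * fps_X * fps_one_minus_powr \<beta>
     - fps_const (b - 1) * fps_X\<^sup>2"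

lemma char_fps_nth_0 [simp]: "char_fps \<alpha> \<beta> a b $ 0 = 1"
  by (simp add: char_fps_def power2_eq_square)

text \<open>The identity is formal, so it covers solutions of any growth. Multiplying by X^2, which
  can be cancelled, clears the shifts of both differences and brings the initial data to the
  right.\<close>

lemma linearized_solution_iff_fps:
  assumes "0 < \<beta>" "\<beta> \<le> 1" "1 < \<alpha>" "\<alpha> \<le> 2"
  shows "linearized_solution \<alpha> \<beta> a f c y \<longleftrightarrow>
    char_fps \<alpha> \<beta> a (deriv f c) * fps_of_seq y =
      fps_const (y 0) * (fps_one_minus_powr (\<alpha> - 2) * (1 - 2 * fps_X)
         + fps_const a * fps_X * fps_one_minus_powr (\<beta> - 1))
      + fps_const (y 1) * (fps_one_minus_powr (\<alpha> - 2) * fps_X)"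
proof -
  let ?b = "deriv f c" and ?Y = "fps_of_seq y"
  let ?D1 = "fps_of_seq (fwd_diff 1 y)" and ?D2 = "fps_of_seq (fwd_diff 2 y)"
  let ?A = "fps_one_minus_powr (\<alpha> - 2)" and ?B = "fps_one_minus_powr (\<beta> - 1)"
  \<comment> \<open>For t = 2 - \<alpha> + n the argument t + \<alpha> - \<beta> - 1 equals 1 -
    \<beta> + n, a grid point of the difference of order \<beta>.\<close>
  have "linearized_solution \<alpha> \<beta> a f c y \<longleftrightarrow>
     (\<forall>n. caputo_diff \<alpha> y (2 - \<alpha> + real n) + a * caputo_diff \<beta> y (1 - \<beta> + real n) = (?b - 1) * y (real n))"
    unfolding linearized_solution_def N_from_def by (simp add: algebra_simps)
  also have "\<dots> \<longleftrightarrow> ?D2 * ?A + fps_const a * (?D1 * ?B) = fps_const (?b - 1) * ?Y"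
    using caputo_diff_eq_fps_nth[of 2 \<alpha> y] caputo_diff_eq_fps_nth[of 1 \<beta> y] assms
    by (simp add: fps_eq_iff del: fps_const_sub)
  also have "\<dots> \<longleftrightarrow> fps_X\<^sup>2 * (?D2 * ?A + fps_const a * (?D1 * ?B)) = fps_X\<^sup>2 * (fps_const (?b - 1) * ?Y)"
    by simp
  also have "fps_X\<^sup>2 * (?D2 * ?A + fps_const a * (?D1 * ?B)) =
      (fps_X\<^sup>2 * ?D2) * ?A + fps_const a * fps_X * ?B * (fps_X * ?D1)"
    by (simp add: algebra_simps power2_eq_square)
  also have "\<dots> = (fps_one_minus_powr \<alpha> + fps_const a * fps_X * fps_one_minus_powr \<beta>) * ?Y
     - (fps_const (y 0) * (?A * (1 - 2 * fps_X) + fps_const a * fps_X * ?B) + fps_const (y 1) * (?A * fps_X))"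
  proof -
    have eqs: "fps_one_minus_powr \<alpha> = ?A * (1 - fps_X)\<^sup>2" "fps_one_minus_powr \<beta> = ?B * (1 - fps_X)"
      using fps_one_minus_powr_add[of "\<alpha> - 2" 2] fps_one_minus_powr_add[of "\<beta> - 1" 1]
      by (simp_all add: fps_one_minus_powr_2 fps_one_minus_powr_1)
    have y1: "fps_const (y 1 - 2 * y 0) = fps_const (y 1) - 2 * fps_const (y 0)"
      by (simp add: fps_eq_iff fps_numeral_nth)
    show ?thesis
      unfolding fps_fwd_diff_1 fps_fwd_diff_2 eqs y1 by (simp add: algebra_simps power2_eq_square)
  qed
  also have "\<dots> = fps_X\<^sup>2 * (fps_const (?b - 1) * ?Y) \<longleftrightarrow> char_fps \<alpha> \<beta> a ?b * ?Y =
      fps_const (y 0) * (?A * (1 - 2 * fps_X) + fps_const a * fps_X * ?B) + fps_const (y 1) * (?A * fps_X)"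
    unfolding char_fps_def diff_eq_eq by (simp add: algebra_simps del: fps_const_sub)
  finally show ?thesis .
qed

section \<open>Evaluation of the characteristic series and the stability criterion\<close>

lemma summable_norm_fps_finite:
  assumes "\<And>n. n \<ge> N \<Longrightarrow> F $ n = 0"
  shows "summable (\<lambda>n. norm (F $ n))"
  by (rule summable_finite[of "{..<N}"]) (use assms in auto)

lemma summable_norm_fps_add:
  assumes "summable (\<lambda>n. norm (F $ n))" "summable (\<lambda>n. norm (G $ n))"
  shows "summable (\<lambda>n. norm ((F + G) $ n))" "summable (\<lambda>n. norm ((F - G) $ n))"
  by (rule summable_comparison_test'[OF summable_add[OF assms], of 0],
      simp add: norm_triangle_ineq norm_triangle_ineq4)+

lemma fps_conv_radius_ge_1:
  fixes F :: "complex fps"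
  assumes "summable (\<lambda>n. norm (F $ n))"
  shows "fps_conv_radius F \<ge> 1"
  using fps_conv_radius_ge_1I[of F] summable_imp_Bseq[OF assms] by (auto simp: Bseq_def)

lemma less_fps_conv_radius:
  assumes "norm w < 1" "fps_conv_radius F \<ge> 1"
  shows "ereal (norm w) < fps_conv_radius F"
  using assms by (metis less_ereal.simps(1) one_ereal_def order.strict_trans2)

lemma eval_fps_summable:
  fixes F G :: "complex fps"
  assumes "norm w < 1" "summable (\<lambda>n. norm (F $ n))" "summable (\<lambda>n. norm (G $ n))"
  shows "eval_fps (F + G) w = eval_fps F w + eval_fps G w"
    and "eval_fps (F - G) w = eval_fps F w - eval_fps G w"
    and "eval_fps (F * G) w = eval_fps F w * eval_fps G w"
  by (intro eval_fps_add eval_fps_diff eval_fps_mult less_fps_conv_radius fps_conv_radius_ge_1 assms)+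

lemma summable_char_fps:
  assumes "0 < \<beta>" "\<beta> \<le> 1" "1 < \<alpha>" "\<alpha> \<le> 2"
  shows "summable (\<lambda>n. norm (char_fps \<alpha> \<beta> a b $ n))"
  unfolding char_fps_def
  by (intro summable_norm_fps_add summable_norm_fps_mult summable_fps_one_minus_powr
      summable_norm_fps_finite[of 3] summable_norm_fps_finite[of 2])
    (use assms in \<open>auto simp: fps_X_power_iff\<close>)

text \<open>In the open disc this is the binomial series. Both sides are continuous on the closed
  disc, so the equality extends to the circle.\<close>

lemma eval_char_fps:
  assumes "0 < \<beta>" "\<beta> \<le> 1" "1 < \<alpha>" "\<alpha> \<le> 2" "norm w \<le> 1"
  shows "eval_fps (fps_of_real (char_fps \<alpha> \<beta> a b)) w = char_fun \<alpha> \<beta> a b w"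
proof -
  let ?F = "fps_of_real (char_fps \<alpha> \<beta> a b)"
  have eq: "eval_fps ?F w - char_fun \<alpha> \<beta> a b w = 0" if w: "w \<in> ball 0 1" for w
  proof -
    have w1: "norm w < 1" using w by simp
    have sums: "summable (\<lambda>n. norm (fps_one_minus_powr (complex_of_real \<alpha>) $ n))"
      "summable (\<lambda>n. norm (fps_one_minus_powr (complex_of_real \<beta>) $ n))"
      using summable_fps_one_minus_powr[of \<alpha>] summable_fps_one_minus_powr[of \<beta>] assms
      unfolding fps_of_real_one_minus_powr[symmetric] by simp_all
    have sums': "summable (\<lambda>n. norm (fps_X $ n))" "summable (\<lambda>n. norm (fps_const c $ n))" for c :: complex
      by (rule summable_norm_fps_finite[of 2]; auto)+
    have "eval_fps ?F w = eval_fps (fps_one_minus_powr (of_real \<alpha>)) w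
        + of_real a * w * eval_fps (fps_one_minus_powr (of_real \<beta>)) w - of_real (b - 1) * (w * w)"
      unfolding char_fps_def fps_of_real_diff fps_of_real_add fps_of_real_mult fps_of_real_const
        fps_of_real_X fps_of_real_one_minus_powr power2_eq_square
      by (simp only: eval_fps_summable[OF w1] summable_norm_fps_mult summable_norm_fps_add sums sums'
          eval_fps_const eval_fps_X)
    then show ?thesis using w by (simp add: eval_fps_one_minus_powr char_fun_def power2_eq_square)
  qed
  have "continuous_on (cball 0 1) (\<lambda>w. eval_fps ?F w - char_fun \<alpha> \<beta> a b w)"
    using summable_char_fps[of \<beta> \<alpha> a b] assms
    by (intro continuous_on_diff continuous_on_eval_fps_cball char_fun_continuous) auto
  from continuous_constant_on_closure[of "ball 0 1" _ 0 w, simplified, OF this] eq assms(5)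
  show ?thesis by simp
qed

theorem asymptotically_stable_iff:
  assumes par: "0 < \<beta>" "\<beta> \<le> 1" "1 < \<alpha>" "\<alpha> \<le> 2"
    and circle: "\<And>w. norm w = 1 \<Longrightarrow> char_fun \<alpha> \<beta> a (deriv f c) w \<noteq> 0"
  shows "asymptotically_stable (linearized_solution \<alpha> \<beta> a f c) \<longleftrightarrow>
    (\<forall>w\<in>cball 0 1. char_fun \<alpha> \<beta> a (deriv f c) w \<noteq> 0)"
proof -
  define D where "D = char_fps \<alpha> \<beta> a (deriv f c)"
  define R0 where "R0 = fps_one_minus_powr (\<alpha> - 2) * (1 - 2 * fps_X)
    + fps_const a * fps_X * fps_one_minus_powr (\<beta> - 1)"
  define R1 where "R1 = fps_one_minus_powr (\<alpha> - 2) * fps_X"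
  note sol_iff = linearized_solution_iff_fps[OF par, of a f c, folded D_def R0_def R1_def]
  have D0: "D $ 0 \<noteq> 0" by (simp add: D_def)
  show ?thesis
  proof
    assume nz: "\<forall>w\<in>cball 0 1. char_fun \<alpha> \<beta> a (deriv f c) w \<noteq> 0"
    have "summable (\<lambda>n. norm (inverse (fps_of_real D) $ n))"
      by (rule wiener_fps)
        (use summable_char_fps[OF par, of a "deriv f c"] nz eval_char_fps[OF par] in \<open>auto simp: D_def\<close>)
    then have inv: "summable (\<lambda>n. norm (inverse D $ n))"
      unfolding fps_of_real_inverse[OF D0, symmetric] by simp
    have tA: "(\<lambda>n. fps_one_minus_powr (\<alpha> - 2) $ n) \<longlonglongrightarrow> 0"
      and tB: "(\<lambda>n. fps_one_minus_powr (\<beta> - 1) $ n) \<longlonglongrightarrow> 0"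
      using par by (auto intro!: fps_one_minus_powr_tendsto_0)
    have "(\<lambda>n. ((1 - 2 * fps_X) * fps_one_minus_powr (\<alpha> - 2)) $ n +
        (fps_const a * fps_X * fps_one_minus_powr (\<beta> - 1)) $ n) \<longlonglongrightarrow> 0 + 0"
      by (intro tendsto_add fps_mult_nth_tendsto_0 tA tB summable_norm_fps_finite[of 2])
        (auto simp: fps_X_def fps_numeral_nth)
    then have "(\<lambda>n. R0 $ n) \<longlonglongrightarrow> 0" by (simp add: R0_def mult.commute)
    then have t0: "(\<lambda>n. (inverse D * R0) $ n) \<longlonglongrightarrow> 0" by (rule fps_mult_nth_tendsto_0[OF inv])
    have "(\<lambda>n. (fps_X * fps_one_minus_powr (\<alpha> - 2)) $ n) \<longlonglongrightarrow> 0"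
      by (intro fps_mult_nth_tendsto_0 tA summable_norm_fps_finite[of 2]) auto
    then have "(\<lambda>n. R1 $ n) \<longlonglongrightarrow> 0" by (simp add: R1_def mult.commute)
    then have t1: "(\<lambda>n. (inverse D * R1) $ n) \<longlonglongrightarrow> 0" by (rule fps_mult_nth_tendsto_0[OF inv])
    \<comment> \<open>Every solution combines two fixed null sequences with weights y 0 and y 1;
      their limits give attraction and their bounds give stability.\<close>
    have y_eq: "y (real n) = y 0 * (inverse D * R0) $ n + y 1 * (inverse D * R1) $ n"
      if "linearized_solution \<alpha> \<beta> a f c y" for y n
    proof -
      have "fps_of_seq y = inverse D * (D * fps_of_seq y)"
        using inverse_mult_eq_1[OF D0] by (simp add: mult.assoc[symmetric])
      also have "\<dots> = fps_const (y 0) * (inverse D * R0) + fps_const (y 1) * (inverse D * R1)"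
        using that unfolding sol_iff by (simp add: algebra_simps)
      finally have "fps_of_seq y $ n = (fps_const (y 0) * (inverse D * R0) + fps_const (y 1) * (inverse D * R1)) $ n"
        by simp
      then show ?thesis by simp
    qed
    obtain B0 where B0: "B0 > 0" "\<And>n. \<bar>(inverse D * R0) $ n\<bar> \<le> B0"
      using convergent_imp_Bseq[OF convergentI[OF t0]] by (auto simp: Bseq_def)
    obtain B1 where B1: "B1 > 0" "\<And>n. \<bar>(inverse D * R1) $ n\<bar> \<le> B1"
      using convergent_imp_Bseq[OF convergentI[OF t1]] by (auto simp: Bseq_def)
    show "asymptotically_stable (linearized_solution \<alpha> \<beta> a f c)"
      unfolding asymptotically_stable_def
    proof safe
      fix \<epsilon> :: real assume "\<epsilon> > 0"
      define \<delta> where "\<delta> = \<epsilon> / (B0 + B1)"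
      have \<delta>: "\<delta> > 0" "\<delta> * B0 + \<delta> * B1 = \<epsilon>"
        using \<open>\<epsilon> > 0\<close> B0(1) B1(1) by (simp_all add: \<delta>_def add_divide_distrib[symmetric] distrib_left[symmetric])
      show "\<exists>\<delta>>0. \<forall>y. linearized_solution \<alpha> \<beta> a f c y \<longrightarrow> \<bar>y 0\<bar> < \<delta> \<longrightarrow> \<bar>y 1\<bar> < \<delta> \<longrightarrow>
          (\<forall>n::nat. \<bar>y (real n)\<bar> < \<epsilon>)"
      proof (intro exI[of _ \<delta>] conjI allI impI \<delta>(1))
        fix y n assume y: "linearized_solution \<alpha> \<beta> a f c y" "\<bar>y 0\<bar> < \<delta>" "\<bar>y 1\<bar> < \<delta>"
        have "\<bar>y (real n)\<bar> \<le> \<bar>y 0\<bar> * \<bar>(inverse D * R0) $ n\<bar> + \<bar>y 1\<bar> * \<bar>(inverse D * R1) $ n\<bar>"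
          unfolding y_eq[OF y(1)] abs_mult[symmetric] by (rule abs_triangle_ineq)
        also have "\<dots> \<le> \<bar>y 0\<bar> * B0 + \<bar>y 1\<bar> * B1"
          by (intro add_mono mult_left_mono B0 B1) auto
        also have "\<dots> < \<delta> * B0 + \<delta> * B1"
          by (intro add_strict_mono mult_strict_right_mono y B0 B1)
        finally show "\<bar>y (real n)\<bar> < \<epsilon>" using \<delta> by simp
      qed
    next
      fix y assume y: "linearized_solution \<alpha> \<beta> a f c y"
      have "(\<lambda>n. y 0 * (inverse D * R0) $ n + y 1 * (inverse D * R1) $ n) \<longlonglongrightarrow> y 0 * 0 + y 1 * 0"
        by (intro tendsto_intros t0 t1)
      then show "(\<lambda>n. y (real n)) \<longlonglongrightarrow> 0" by (simp add: y_eq[OF y])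
    qed
  next
    assume stable: "asymptotically_stable (linearized_solution \<alpha> \<beta> a f c)"
    show "\<forall>w\<in>cball 0 1. char_fun \<alpha> \<beta> a (deriv f c) w \<noteq> 0"
    proof safe
      fix w assume w: "w \<in> cball 0 1" "char_fun \<alpha> \<beta> a (deriv f c) w = 0"
      have w1: "norm w < 1" using w circle[of w] by (auto simp: le_less)
      have w0: "w \<noteq> 0" using w(2) by (auto simp: char_fun_def)
      \<comment> \<open>X * G is R1 / D, the solution with y 0 = 0 and y 1 = 1; the floor below only
        extends it to real arguments.\<close>
      define G where "G = inverse D * fps_one_minus_powr (\<alpha> - 2)"
      define y where "y t = (fps_X * G) $ (nat \<lfloor>t\<rfloor>)" for t :: real
      have Y: "fps_of_seq y = fps_X * G" by (rule fps_ext) (simp add: y_def)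
      have y01: "y 0 = 0" "y 1 = 1" by (simp_all add: y_def G_def D_def)
      have "D * fps_of_seq y = (inverse D * D) * R1"
        unfolding Y G_def R1_def by (simp only: mult_ac)
      then have DY: "D * fps_of_seq y = R1" using inverse_mult_eq_1[OF D0] by simp
      then have "linearized_solution \<alpha> \<beta> a f c y" unfolding sol_iff y01 by simp
      with stable have "(\<lambda>n. y (real n)) \<longlonglongrightarrow> 0" unfolding asymptotically_stable_def by blast
      \<comment> \<open>Convergence to 0 bounds the coefficients, so the generating function of y
        can be evaluated at the zero w of D.\<close>
      then obtain B where B: "\<And>n. \<bar>y (real n)\<bar> \<le> B"
        using convergent_imp_Bseq[OF convergentI] by (fastforce simp: Bseq_def)
      have rY: "fps_conv_radius (fps_of_real (fps_of_seq y)) \<ge> 1"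
        by (rule fps_conv_radius_ge_1I[of _ B]) (simp add: B)
      have rD: "fps_conv_radius (fps_of_real D) \<ge> 1"
        by (rule fps_conv_radius_ge_1) (use summable_char_fps[OF par] in \<open>simp add: D_def\<close>)
      \<comment> \<open>The contradiction: D(w) Y(w) is 0, yet it equals w (1 - w)^(\<alpha> - 2),
        which is nonzero for 0 < norm w < 1.\<close>
      have "0 = eval_fps (fps_of_real D) w * eval_fps (fps_of_real (fps_of_seq y)) w"
        using eval_char_fps[OF par, of w] w by (simp add: D_def)
      also have "\<dots> = eval_fps (fps_of_real R1) w"
        by (simp add: eval_fps_mult[symmetric] less_fps_conv_radius[OF w1] rD rY fps_of_real_mult[symmetric] DY)
      also have "\<dots> = (1 - w) powr of_real (\<alpha> - 2) * w"
        unfolding R1_def fps_of_real_mult fps_of_real_one_minus_powr fps_of_real_X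
        by (subst eval_fps_mult)
          (use w1 in \<open>auto intro!: less_fps_conv_radius fps_conv_radius_one_minus_powr simp: eval_fps_one_minus_powr\<close>)
      finally show False using w0 w1 by auto
    qed
  qed
qed

section \<open>Equilibria and the logistic family\<close>

lemma equilibrium_iff:
  assumes "0 < \<beta>" "\<beta> \<le> 1" "1 < \<alpha>" "\<alpha> \<le> 2"
  shows "equilibrium \<alpha> \<beta> a f c \<longleftrightarrow> f c = c"
proof -
  have diff: "fps_of_seq (fwd_diff 1 (\<lambda>_. c)) = 0" "fps_of_seq (fwd_diff 2 (\<lambda>_. c)) = 0"
    by (rule fps_ext; simp add: fwd_diff_1 fwd_diff_2)+
  have "equilibrium \<alpha> \<beta> a f c \<longleftrightarrow> (\<forall>n. caputo_diff \<alpha> (\<lambda>_. c) (2 - \<alpha> + real n) +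
      a * caputo_diff \<beta> (\<lambda>_. c) (1 - \<beta> + real n) = f c - c)"
    unfolding equilibrium_def solution_def N_from_def by (simp add: algebra_simps)
  then show ?thesis
    using caputo_diff_eq_fps_nth[of 2 \<alpha> "\<lambda>_. c"] caputo_diff_eq_fps_nth[of 1 \<beta> "\<lambda>_. c"] assms
    unfolding diff by simp
qed

lemma asymptotically_stable_iff_Ind:
  assumes "0 < \<beta>" "\<beta> \<le> 1" "1 < \<alpha>" "\<alpha> \<le> 2"
    and "of_real (deriv f c) \<notin> gamma_curve \<alpha> \<beta> a ` {0..2 * pi}"
  shows "asymptotically_stable (linearized_solution \<alpha> \<beta> a f c) \<longleftrightarrow>
    Ind (gamma_curve \<alpha> \<beta> a) (of_real (deriv f c)) = 2"
  using asymptotically_stable_iff[OF assms(1-4) char_fun_nonzero_on_circle[OF assms(5)]]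
    Ind_gamma_curve_eq_2_iff[OF assms(5)] assms(1,3) by simp

lemma deriv_logistic: "deriv (logistic \<mu>) x = \<mu> * (1 - 2 * x)"
  unfolding logistic_def[abs_def]
  by (rule DERIV_imp_deriv) (auto intro!: derivative_eq_intros simp: algebra_simps)

theorem corollary3p4:
  fixes \<alpha> \<beta> a :: real
  assumes "0 < \<beta>" and "\<beta> \<le> 1" and "1 < \<alpha>" and "\<alpha> \<le> 2" and "a > 0"
  shows
    "(\<forall>(f :: real \<Rightarrow> real) (xs :: real).
        f C1_differentiable_on UNIV \<longrightarrow>
        equilibrium \<alpha> \<beta> a f xs \<longrightarrow>
        of_real (deriv f xs) \<notin> gamma_curve \<alpha> \<beta> a ` {0..2 * pi} \<longrightarrow>
        f xs = xs \<and>
        (asymptotically_stable (linearized_solution \<alpha> \<beta> a f xs) \<longleftrightarrow>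
           Ind (gamma_curve \<alpha> \<beta> a) (of_real (deriv f xs)) = 2)) \<and>
     (\<forall>\<mu> :: real.
        equilibrium \<alpha> \<beta> a (logistic \<mu>) 0 \<and>
        deriv (logistic \<mu>) 0 = \<mu> \<and>
        (of_real \<mu> \<notin> gamma_curve \<alpha> \<beta> a ` {0..2 * pi} \<longrightarrow>
           (asymptotically_stable (linearized_solution \<alpha> \<beta> a (logistic \<mu>) 0) \<longleftrightarrow>
              Ind (gamma_curve \<alpha> \<beta> a) (of_real \<mu>) = 2))) \<and>
     (\<forall>\<mu> :: real. \<mu> \<noteq> 0 \<longrightarrow>
        equilibrium \<alpha> \<beta> a (logistic \<mu>) (1 - 1 / \<mu>) \<and>
        deriv (logistic \<mu>) (1 - 1 / \<mu>) = 2 - \<mu> \<and>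
        (of_real (2 - \<mu>) \<notin> gamma_curve \<alpha> \<beta> a ` {0..2 * pi} \<longrightarrow>
           (asymptotically_stable (linearized_solution \<alpha> \<beta> a (logistic \<mu>) (1 - 1 / \<mu>)) \<longleftrightarrow>
              Ind (gamma_curve \<alpha> \<beta> a) (of_real (2 - \<mu>)) = 2)))"
proof (intro conjI allI impI)
  note equil = equilibrium_iff[OF assms(1-4)]
  note stable = asymptotically_stable_iff_Ind[OF assms(1-4)]
  have deriv0: "deriv (logistic \<mu>) 0 = \<mu>" for \<mu>
    by (simp add: deriv_logistic)
  have deriv1: "deriv (logistic \<mu>) (1 - 1 / \<mu>) = 2 - \<mu>" if "\<mu> \<noteq> 0" for \<mu>
    using that by (simp add: deriv_logistic field_simps)
  {
    fix f :: "real \<Rightarrow> real" and xs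
    assume "equilibrium \<alpha> \<beta> a f xs"
    then show "f xs = xs" by (simp add: equil)
  next
    fix f :: "real \<Rightarrow> real" and xs
    assume "of_real (deriv f xs) \<notin> gamma_curve \<alpha> \<beta> a ` {0..2 * pi}"
    then show "asymptotically_stable (linearized_solution \<alpha> \<beta> a f xs) \<longleftrightarrow>
        Ind (gamma_curve \<alpha> \<beta> a) (of_real (deriv f xs)) = 2"
      by (rule stable)
  next
    fix \<mu> :: real
    show "equilibrium \<alpha> \<beta> a (logistic \<mu>) 0" by (simp add: equil logistic_def)
    show "deriv (logistic \<mu>) 0 = \<mu>" by (rule deriv0)
    assume "of_real \<mu> \<notin> gamma_curve \<alpha> \<beta> a ` {0..2 * pi}"
    then show "asymptotically_stable (linearized_solution \<alpha> \<beta> a (logistic \<mu>) 0) \<longleftrightarrow>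
        Ind (gamma_curve \<alpha> \<beta> a) (of_real \<mu>) = 2"
      using stable[of "logistic \<mu>" 0] unfolding deriv0 by blast
  next
    fix \<mu> :: real assume \<mu>: "\<mu> \<noteq> 0"
    show "equilibrium \<alpha> \<beta> a (logistic \<mu>) (1 - 1 / \<mu>)"
      using \<mu> by (simp add: equil logistic_def field_simps)
    show "deriv (logistic \<mu>) (1 - 1 / \<mu>) = 2 - \<mu>" by (rule deriv1[OF \<mu>])
    assume "of_real (2 - \<mu>) \<notin> gamma_curve \<alpha> \<beta> a ` {0..2 * pi}"
    then show "asymptotically_stable (linearized_solution \<alpha> \<beta> a (logistic \<mu>) (1 - 1 / \<mu>)) \<longleftrightarrow>
        Ind (gamma_curve \<alpha> \<beta> a) (of_real (2 - \<mu>)) = 2"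
      using stable[of "logistic \<mu>" "1 - 1 / \<mu>"] unfolding deriv1[OF \<mu>] by blast
  }
qed

end
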